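(* Let $R$ be a commutative ring with identity and $\mathbf a,\mathbf b\in\mathcal W(R)$ with characteristic polynomials $p_a(t)$ of degree $M$ with roots $\alpha_1,\dots,\alpha_M$ and $p_b(t)$ of degree $N$ with roots $\beta_1,\dots,\beta_N$. Then $\mathbf c=\mathbf a\boxtimes\mathbf b\in\mathcal W(R)$, and $\mathbf c$ has characteristic polynomial $\prod_{i=1}^M\prod_{j=1}^N\bigl(t-(\alpha_i+\beta_j+\alpha_i\beta_j)\bigr)$. Moreover, $(\mathcal W(R),+,\boxtimes)$ is an $R$-algebra.
   Context: $\mathcal S(R)$ is the set of sequences $(a_n)_{n\ge0}$ in $R$. A sequence is linear recurrent with (monic) characteristic polynomial $p_a(t)=t^N-\sum_{i=1}^{N}h_it^{N-i}\in R[t]$ if $a_n=\sum_{i=1}^{N}h_ia_{n-i}$ for all $n\ge N$ (not necessarily minimal); $\mathcal W(R)$ is the set of linear recurrent sequences. The roots of the polynomials are taken in a suitable extension; the displayed product has coefficients in $R$. Operations: componentwise sum $(\mathbf a+\mathbf b)_n=a_n+b_n$; Newton product $(\mathbf a\boxtimes\mathbf b)_n=\sum_{i=0}^n\sum_{j=0}^i\binom{n}{i}\binom{i}{j}a_ib_{n-j}$. *)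

theory Defs
  imports "HOL-Algebra.UnivPoly"
begin

definition seqs :: "('a, 'm) ring_scheme \<Rightarrow> (nat \<Rightarrow> 'a) set" where
  "seqs R = {a. \<forall>n. a n \<in> carrier R}"

text \<open>
  The degree \<open>N\<close> is an explicit argument because it is not determined by the polynomial when
  \<open>R\<close> is the zero ring. The value \<open>N = 0\<close> is allowed; it describes the zero sequence only.
\<close>

definition has_charpoly ::
    "('a, 'm) ring_scheme \<Rightarrow> nat \<Rightarrow> (nat \<Rightarrow> 'a) \<Rightarrow> (nat \<Rightarrow> 'a) \<Rightarrow> bool" where
  "has_charpoly R N p a \<longleftrightarrow>
     (\<exists>h \<in> {1..N} \<rightarrow> carrier R.
        p = monom (UP R) \<one>\<^bsub>R\<^esub> N
              \<ominus>\<^bsub>UP R\<^esub> (\<Oplus>\<^bsub>UP R\<^esub>i\<in>{1..N}. monom (UP R) (h i) (N - i)) \<and>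
        (\<forall>n\<ge>N. a n = (\<Oplus>\<^bsub>R\<^esub>i\<in>{1..N}. h i \<otimes>\<^bsub>R\<^esub> a (n - i))))"

definition linrec_seqs :: "('a, 'm) ring_scheme \<Rightarrow> (nat \<Rightarrow> 'a) set" where
  "linrec_seqs R = {a \<in> seqs R. \<exists>N p. has_charpoly R N p a}"

definition newton_prod ::
    "('a, 'm) ring_scheme \<Rightarrow> (nat \<Rightarrow> 'a) \<Rightarrow> (nat \<Rightarrow> 'a) \<Rightarrow> (nat \<Rightarrow> 'a)" where
  "newton_prod R a b =
     (\<lambda>n. \<Oplus>\<^bsub>R\<^esub>i\<in>{0..n}. \<Oplus>\<^bsub>R\<^esub>j\<in>{0..i}.
        add_pow R ((n choose i) * (i choose j)) (a i \<otimes>\<^bsub>R\<^esub> b (n - j)))"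

definition linrec_algebra :: "('a, 'm) ring_scheme \<Rightarrow> ('a, nat \<Rightarrow> 'a) module" where
  "linrec_algebra R =
     \<lparr>carrier = linrec_seqs R,
      mult = newton_prod R,
      one = (\<lambda>n. if n = 0 then \<one>\<^bsub>R\<^esub> else \<zero>\<^bsub>R\<^esub>),
      zero = (\<lambda>n. \<zero>\<^bsub>R\<^esub>),
      add = (\<lambda>a b n. a n \<oplus>\<^bsub>R\<^esub> b n),
      smult = (\<lambda>r a n. r \<otimes>\<^bsub>R\<^esub> a n)\<rparr>"

text \<open>An extension of \<open>R\<close> is given by an embedding, so that it may live on another type.\<close>

definition ring_extension ::
    "('a, 'm) ring_scheme \<Rightarrow> ('b, 'n) ring_scheme \<Rightarrow> ('a \<Rightarrow> 'b) \<Rightarrow> bool" where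
  "ring_extension R S \<phi> \<longleftrightarrow> cring S \<and> \<phi> \<in> ring_hom R S \<and> inj_on \<phi> (carrier R)"

definition UP_map :: "('a, 'm) ring_scheme \<Rightarrow> ('a \<Rightarrow> 'b) \<Rightarrow> (nat \<Rightarrow> 'a) \<Rightarrow> (nat \<Rightarrow> 'b)" where
  "UP_map R \<phi> p = (\<lambda>k. \<phi> (coeff (UP R) p k))"

definition lin_factor :: "('b, 'n) ring_scheme \<Rightarrow> 'b \<Rightarrow> (nat \<Rightarrow> 'b)" where
  "lin_factor S x = monom (UP S) \<one>\<^bsub>S\<^esub> 1 \<ominus>\<^bsub>UP S\<^esub> monom (UP S) x 0"

text \<open>The list of roots is counted with multiplicity: \<open>p\<close> splits over \<open>S\<close> as the product of
  the \<open>t - \<alpha> i\<close>.\<close>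

definition has_roots ::
    "('a, 'm) ring_scheme \<Rightarrow> ('b, 'n) ring_scheme \<Rightarrow> ('a \<Rightarrow> 'b) \<Rightarrow> (nat \<Rightarrow> 'a) \<Rightarrow> nat \<Rightarrow> (nat \<Rightarrow> 'b) \<Rightarrow> bool"
where
  "has_roots R S \<phi> p N \<alpha> \<longleftrightarrow>
     \<alpha> \<in> {1..N} \<rightarrow> carrier S \<and>
     UP_map R \<phi> p = (\<Otimes>\<^bsub>UP S\<^esub>i\<in>{1..N}. lin_factor S (\<alpha> i))"

end

theory Submission
  imports Defs "HOL-Algebra.Weak_Morphisms" "HOL-Algebra.Subrings" "HOL-Library.Nat_Bijection"
begin

text \<open>
  The binomial transform turns \<open>\<boxtimes>\<close> into the componentwise product and adds \<open>1\<close> to the roots of a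
  characteristic polynomial. Since \<open>(1 + \<alpha>) (1 + \<beta>) = 1 + (\<alpha> + \<beta> + \<alpha> \<beta>)\<close>, the recurrence for
  \<open>a \<boxtimes> b\<close> over a ring \<open>S\<close> in which both polynomials split follows from the one for
  componentwise products, which are annihilated by the pairwise products of the roots; the algebra
  axioms are likewise those of the componentwise product.

  That the product polynomial has coefficients in \<open>R\<close> is shown without symmetric functions. Adjoin a
  second, generic family \<open>\<beta>'\<close> of roots of \<open>p\<^sub>b\<close> to \<open>S\<close>, by iterating \<open>S[t]/(p)\<close>. Then
  \<open>R[\<beta>'] \<inter> S = R\<close>, because division by a monic polynomial over \<open>R\<close> is the same over \<open>R\<close>
  and over \<open>S\<close>. Writing \<open>t - (\<alpha> + \<beta> + \<alpha> \<beta>) = (t - \<alpha>) - \<beta> (1 + \<alpha>)\<close>, the product over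
  the \<open>\<beta>\<close> is the homogenization of \<open>p\<^sub>b\<close> at \<open>(t - \<alpha>, 1 + \<alpha>)\<close>. So the double product does not
  change when the \<open>\<beta>\<close> are replaced by the \<open>\<beta>'\<close>, and its coefficients lie in \<open>S\<close>; by symmetry
  they also lie in \<open>R[\<beta>']\<close>, hence in \<open>R\<close>.
\<close>

section \<open>Annihilators and componentwise products of sequences\<close>

definition lin_op :: "('a, 'm) ring_scheme \<Rightarrow> 'a \<Rightarrow> (nat \<Rightarrow> 'a) \<Rightarrow> nat \<Rightarrow> 'a" where
  "lin_op R x u = (\<lambda>n. u (Suc n) \<ominus>\<^bsub>R\<^esub> x \<otimes>\<^bsub>R\<^esub> u n)"

text \<open>
  \<open>lin_op R x\<close> is the action of \<open>t - x\<close> on sequences, \<open>t\<close> acting as the shift, so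
  \<open>fold (lin_op R) xs\<close> is the action of the polynomial with list of roots \<open>xs\<close>, whose
  coefficients are \<open>root_coeffs R xs\<close>.
\<close>

definition annihilated :: "('a, 'm) ring_scheme \<Rightarrow> 'a list \<Rightarrow> (nat \<Rightarrow> 'a) set" where
  "annihilated R xs = {u \<in> seqs R. fold (lin_op R) xs u = (\<lambda>n. \<zero>\<^bsub>R\<^esub>)}"

fun root_coeffs :: "('a, 'm) ring_scheme \<Rightarrow> 'a list \<Rightarrow> nat \<Rightarrow> 'a" where
  "root_coeffs R [] k = (if k = 0 then \<one>\<^bsub>R\<^esub> else \<zero>\<^bsub>R\<^esub>)"
| "root_coeffs R (x # xs) k =
     (case k of 0 \<Rightarrow> \<zero>\<^bsub>R\<^esub> | Suc j \<Rightarrow> root_coeffs R xs j) \<ominus>\<^bsub>R\<^esub> x \<otimes>\<^bsub>R\<^esub> root_coeffs R xs k"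

text \<open>In closed form this is the sum over \<open>k\<close> of \<open>(n choose k) u k\<close>:
  the operator "identity plus shift" is applied \<open>n\<close> times and the result is read at
  index 0. The recursive form keeps binomial coefficients out of the proofs about it.\<close>

fun binomial_transform :: "('a, 'm) ring_scheme \<Rightarrow> (nat \<Rightarrow> 'a) \<Rightarrow> nat \<Rightarrow> 'a" where
  "binomial_transform R u 0 = u 0"
| "binomial_transform R u (Suc n) = binomial_transform R (\<lambda>k. u k \<oplus>\<^bsub>R\<^esub> u (Suc k)) n"

lemma seqsD: "u \<in> seqs R \<Longrightarrow> u n \<in> carrier R"
  by (simp add: seqs_def)

lemma seqsI: "(\<And>n. u n \<in> carrier R) \<Longrightarrow> u \<in> seqs R"
  by (simp add: seqs_def)

context cring
begin

lemma root_coeffs_closed: "set xs \<subseteq> carrier R \<Longrightarrow> root_coeffs R xs k \<in> carrier R"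
  by (induction xs arbitrary: k) (auto split: nat.split)

lemma root_coeffs_above: "set xs \<subseteq> carrier R \<Longrightarrow> length xs < k \<Longrightarrow> root_coeffs R xs k = \<zero>"
  by (induction xs arbitrary: k) (auto split: nat.split simp: minus_eq)

lemma root_coeffs_lead: "set xs \<subseteq> carrier R \<Longrightarrow> root_coeffs R xs (length xs) = \<one>"
  by (induction xs) (auto simp: root_coeffs_above minus_eq)

lemma lin_op_closed: "x \<in> carrier R \<Longrightarrow> u \<in> seqs R \<Longrightarrow> lin_op R x u \<in> seqs R"
  by (simp add: lin_op_def seqs_def)

lemma fold_lin_op_closed:
  "set xs \<subseteq> carrier R \<Longrightarrow> u \<in> seqs R \<Longrightarrow> fold (lin_op R) xs u \<in> seqs R"
  by (induction xs arbitrary: u) (auto simp: lin_op_closed)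

text \<open>Expands the product of linear factors one factor at a time: a new factor
  \<open>t - x\<close> moves the coefficients up by one index and subtracts \<open>x\<close> times
  the old ones. This connects the factorwise action with a recurrence that has explicit
  coefficients.\<close>

lemma fold_lin_op_eq_sum:
  assumes "set xs \<subseteq> carrier R" "u \<in> seqs R"
  shows "fold (lin_op R) xs u m = (\<Oplus>k\<in>{..length xs}. root_coeffs R xs k \<otimes> u (m + k))"
  using assms
proof (induction xs arbitrary: u)
  case Nil
  then show ?case by (simp add: seqsD)
next
  case (Cons x xs)
  let ?n = "length xs" and ?c = "root_coeffs R xs"
  have xs: "set xs \<subseteq> carrier R" and x: "x \<in> carrier R" using Cons.prems by auto
  note [simp] = root_coeffs_closed[OF xs] x seqsD[OF Cons.prems(2)]
  have "fold (lin_op R) (x # xs) u m = (\<Oplus>k\<in>{..?n}. ?c k \<otimes> lin_op R x u (m + k))"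
    using Cons.IH[OF xs lin_op_closed[OF x Cons.prems(2)]] by simp
  also have "\<dots> = (\<Oplus>k\<in>{..?n}. ?c k \<otimes> u (m + Suc k) \<oplus> (\<ominus> x) \<otimes> (?c k \<otimes> u (m + k)))"
    by (rule finsum_cong') (auto simp: lin_op_def minus_eq r_distr l_minus r_minus m_lcomm)
  also have "\<dots> = (\<Oplus>k\<in>{..?n}. ?c k \<otimes> u (m + Suc k)) \<oplus> (\<ominus> x) \<otimes> (\<Oplus>k\<in>{..?n}. ?c k \<otimes> u (m + k))"
    by (simp add: finsum_addf finsum_rdistr)
  \<comment> \<open>Both sums are brought to the range \<open>{..Suc ?n}\<close>: the shifted one
    gains coefficient 0 at index 0, the other gains \<open>?c (Suc ?n)\<close>, which is 0.\<close>
  also have "(\<Oplus>k\<in>{..?n}. ?c k \<otimes> u (m + Suc k)) =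
      (\<Oplus>k\<in>{..Suc ?n}. (case k of 0 \<Rightarrow> \<zero> | Suc j \<Rightarrow> ?c j) \<otimes> u (m + k))"
    by (subst finsum_Suc2) (auto split: nat.split)
  also have "(\<Oplus>k\<in>{..?n}. ?c k \<otimes> u (m + k)) = (\<Oplus>k\<in>{..Suc ?n}. ?c k \<otimes> u (m + k))"
    by (simp add: root_coeffs_above[OF xs])
  also have "(\<Oplus>k\<in>{..Suc ?n}. (case k of 0 \<Rightarrow> \<zero> | Suc j \<Rightarrow> ?c j) \<otimes> u (m + k)) \<oplus>
       (\<ominus> x) \<otimes> (\<Oplus>k\<in>{..Suc ?n}. ?c k \<otimes> u (m + k)) =
       (\<Oplus>k\<in>{..Suc ?n}. (case k of 0 \<Rightarrow> \<zero> | Suc j \<Rightarrow> ?c j) \<otimes> u (m + k) \<oplus> (\<ominus> x) \<otimes> (?c k \<otimes> u (m + k)))"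
    by (subst finsum_rdistr) (auto simp: finsum_addf split: nat.split simp del: finsum_Suc)
  also have "\<dots> = (\<Oplus>k\<in>{..Suc ?n}. root_coeffs R (x # xs) k \<otimes> u (m + k))"
    by (rule finsum_cong')
      (auto simp: minus_eq l_distr l_minus m_assoc split: nat.split)
  finally show ?case by simp
qed

section \<open>Linearity and commutation of the operators; stability of the annihilated
  sequences\<close>

lemma lin_op_add:
  "x \<in> carrier R \<Longrightarrow> u \<in> seqs R \<Longrightarrow> v \<in> seqs R \<Longrightarrow>
    lin_op R x (\<lambda>n. u n \<oplus> v n) = (\<lambda>n. lin_op R x u n \<oplus> lin_op R x v n)"
  by (rule ext) (simp add: lin_op_def seqsD minus_eq r_distr minus_add a_ac)

lemma lin_op_smult:
  "x \<in> carrier R \<Longrightarrow> c \<in> carrier R \<Longrightarrow> u \<in> seqs R \<Longrightarrow>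
    lin_op R x (\<lambda>n. c \<otimes> u n) = (\<lambda>n. c \<otimes> lin_op R x u n)"
  by (rule ext) (simp add: lin_op_def seqsD minus_eq r_distr r_minus m_lcomm)

lemma lin_op_shift: "lin_op R x (\<lambda>n. u (Suc n)) = (\<lambda>n. lin_op R x u (Suc n))"
  by (simp add: lin_op_def)

lemma seqs_add: "u \<in> seqs R \<Longrightarrow> v \<in> seqs R \<Longrightarrow> (\<lambda>n. u n \<oplus> v n) \<in> seqs R"
  and seqs_mult: "u \<in> seqs R \<Longrightarrow> v \<in> seqs R \<Longrightarrow> (\<lambda>n. u n \<otimes> v n) \<in> seqs R"
  and seqs_smult: "c \<in> carrier R \<Longrightarrow> u \<in> seqs R \<Longrightarrow> (\<lambda>n. c \<otimes> u n) \<in> seqs R"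
  and seqs_shift: "u \<in> seqs R \<Longrightarrow> (\<lambda>n. u (Suc n)) \<in> seqs R"
  and seqs_zero: "(\<lambda>n. \<zero>) \<in> seqs R"
  by (simp_all add: seqs_def)

lemma fold_lin_op_add:
  "set xs \<subseteq> carrier R \<Longrightarrow> u \<in> seqs R \<Longrightarrow> v \<in> seqs R \<Longrightarrow>
    fold (lin_op R) xs (\<lambda>n. u n \<oplus> v n) = (\<lambda>n. fold (lin_op R) xs u n \<oplus> fold (lin_op R) xs v n)"
  by (induction xs arbitrary: u v) (auto simp: lin_op_add lin_op_closed)

lemma fold_lin_op_smult:
  "set xs \<subseteq> carrier R \<Longrightarrow> c \<in> carrier R \<Longrightarrow> u \<in> seqs R \<Longrightarrow>
    fold (lin_op R) xs (\<lambda>n. c \<otimes> u n) = (\<lambda>n. c \<otimes> fold (lin_op R) xs u n)"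
  by (induction xs arbitrary: u) (auto simp: lin_op_smult lin_op_closed)

lemma fold_lin_op_shift:
  "fold (lin_op R) xs (\<lambda>n. u (Suc n)) = (\<lambda>n. fold (lin_op R) xs u (Suc n))"
  by (induction xs arbitrary: u) (auto simp: lin_op_shift)

lemma lin_op_zero: "x \<in> carrier R \<Longrightarrow> lin_op R x (\<lambda>n. \<zero>) = (\<lambda>n. \<zero>)"
  by (simp add: lin_op_def minus_eq)

lemma fold_lin_op_zero: "set xs \<subseteq> carrier R \<Longrightarrow> fold (lin_op R) xs (\<lambda>n. \<zero>) = (\<lambda>n. \<zero>)"
  by (induction xs) (auto simp: lin_op_zero)

lemma lin_op_commute:
  "x \<in> carrier R \<Longrightarrow> y \<in> carrier R \<Longrightarrow> u \<in> seqs R \<Longrightarrow>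
    lin_op R x (lin_op R y u) = lin_op R y (lin_op R x u)"
  by (rule ext) (simp add: lin_op_def seqsD minus_eq r_distr r_minus l_minus minus_add a_ac m_lcomm)

lemma fold_lin_op_commute:
  "set xs \<subseteq> carrier R \<Longrightarrow> y \<in> carrier R \<Longrightarrow> u \<in> seqs R \<Longrightarrow>
    fold (lin_op R) xs (lin_op R y u) = lin_op R y (fold (lin_op R) xs u)"
proof (induction xs arbitrary: u)
  case (Cons x xs)
  then show ?case
    by (simp add: lin_op_commute[of x y] lin_op_closed)
qed simp

lemma annihilated_closed: "u \<in> annihilated R xs \<Longrightarrow> u \<in> seqs R"
  by (simp add: annihilated_def)

lemma annihilated_zero: "set xs \<subseteq> carrier R \<Longrightarrow> (\<lambda>n. \<zero>) \<in> annihilated R xs"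
  by (simp add: annihilated_def fold_lin_op_zero seqs_zero)

lemma annihilated_add:
  "set xs \<subseteq> carrier R \<Longrightarrow> u \<in> annihilated R xs \<Longrightarrow> v \<in> annihilated R xs \<Longrightarrow>
    (\<lambda>n. u n \<oplus> v n) \<in> annihilated R xs"
  by (auto simp: annihilated_def fold_lin_op_add seqs_add)

lemma annihilated_smult:
  "set xs \<subseteq> carrier R \<Longrightarrow> c \<in> carrier R \<Longrightarrow> u \<in> annihilated R xs \<Longrightarrow>
    (\<lambda>n. c \<otimes> u n) \<in> annihilated R xs"
  by (auto simp: annihilated_def fold_lin_op_smult seqs_smult)

lemma annihilated_shift: "u \<in> annihilated R xs \<Longrightarrow> (\<lambda>n. u (Suc n)) \<in> annihilated R xs"
  by (auto simp: annihilated_def fold_lin_op_shift seqs_shift)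

text \<open>The operators commute, so the factor with root \<open>y\<close> may be applied last,
  where it meets the zero sequence.\<close>

lemma annihilated_lin_op:
  "set xs \<subseteq> carrier R \<Longrightarrow> y \<in> carrier R \<Longrightarrow> u \<in> annihilated R xs \<Longrightarrow>
    lin_op R y u \<in> annihilated R xs"
  by (auto simp: annihilated_def fold_lin_op_commute lin_op_closed lin_op_zero)

lemma annihilated_fold:
  "set xs \<subseteq> carrier R \<Longrightarrow> set ys \<subseteq> carrier R \<Longrightarrow> u \<in> annihilated R xs \<Longrightarrow>
    fold (lin_op R) ys u \<in> annihilated R xs"
  by (induction ys arbitrary: u) (auto simp: annihilated_lin_op)

lemma annihilated_append:
  "set xs \<subseteq> carrier R \<Longrightarrow> u \<in> seqs R \<Longrightarrow>
    u \<in> annihilated R (xs @ ys) \<longleftrightarrow> fold (lin_op R) xs u \<in> annihilated R ys"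
  by (auto simp: annihilated_def fold_lin_op_closed)

lemma annihilated_Cons:
  "u \<in> annihilated R (x # xs) \<Longrightarrow> x \<in> carrier R \<Longrightarrow> lin_op R x u \<in> annihilated R xs"
  by (auto simp: annihilated_def lin_op_closed)

text \<open>A discrete Leibniz rule, obtained by adding and subtracting
  \<open>x u(n) v(n+1)\<close>.\<close>

lemma lin_op_mult:
  assumes "x \<in> carrier R" "y \<in> carrier R" "u \<in> seqs R" "v \<in> seqs R"
  shows "lin_op R (x \<otimes> y) (\<lambda>n. u n \<otimes> v n) =
    (\<lambda>n. lin_op R x u n \<otimes> v (Suc n) \<oplus> (x \<otimes> u n) \<otimes> lin_op R y v n)"
proof
  fix n
  have [simp]: "\<And>n. u n \<in> carrier R" "\<And>n. v n \<in> carrier R" using assms by (auto simp: seqsD)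
  show "lin_op R (x \<otimes> y) (\<lambda>n. u n \<otimes> v n) n =
    lin_op R x u n \<otimes> v (Suc n) \<oplus> (x \<otimes> u n) \<otimes> lin_op R y v n"
    unfolding lin_op_def using assms(1,2) \<open>\<And>n. u n \<in> carrier R\<close> \<open>\<And>n. v n \<in> carrier R\<close> by algebra
qed

text \<open>Over a general ring, and with repeated roots, the solutions of a recurrence need not be
  combinations of geometric sequences. The proof therefore uses no closed form and strips off one
  root at a time.\<close>

lemma annihilated_mult:
  assumes "set xs \<subseteq> carrier R" "set ys \<subseteq> carrier R" "u \<in> annihilated R xs" "v \<in> annihilated R ys"
  shows "(\<lambda>n. u n \<otimes> v n) \<in> annihilated R (concat (map (\<lambda>x. map (\<lambda>y. x \<otimes> y) ys) xs))"
  using assms(1,3,4)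
proof (induction xs arbitrary: u v)
  case Nil
  then show ?case by (auto simp: annihilated_def seqsD seqs_mult)
next
  case (Cons x xs)
  define rs where "rs = concat (map (\<lambda>x. map (\<lambda>y. x \<otimes> y) ys) xs)"
  have x: "x \<in> carrier R" and xs: "set xs \<subseteq> carrier R" using Cons.prems by auto
  have rs: "set rs \<subseteq> carrier R" using xs assms(2) by (auto simp: rs_def subset_iff)
  \<comment> \<open>By \<open>lin_op_mult\<close>, the factor with root \<open>x y\<close> turns \<open>u v\<close> into two products: one in which
    \<open>x\<close> is removed from the roots of \<open>u\<close>, covered by the outer induction, and one in which \<open>y\<close> is
    removed from the roots of \<open>v\<close>, covered by the inner one.\<close>
  have inner: "fold (lin_op R) (map (\<lambda>y. x \<otimes> y) zs) (\<lambda>n. u n \<otimes> v n) \<in> annihilated R rs"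
    if "set zs \<subseteq> carrier R" "u \<in> annihilated R (x # xs)" "v \<in> annihilated R ys"
       "v \<in> annihilated R zs" for zs u v
    using that
  proof (induction zs arbitrary: u v)
    \<comment> \<open>With no roots left in \<open>zs\<close>, the sequence \<open>v\<close> is zero
      and so is the product.\<close>
    case Nil
    then show ?case
      by (auto simp: annihilated_def seqsD seqs_zero fold_lin_op_zero rs)
  next
    case (Cons y zs)
    have y: "y \<in> carrier R" and zs: "set zs \<subseteq> carrier R" using Cons.prems by auto
    have u: "u \<in> seqs R" and v: "v \<in> seqs R" using Cons.prems annihilated_closed by auto
    have xzs: "set (map (\<lambda>y. x \<otimes> y) zs) \<subseteq> carrier R" using x zs by auto
    let ?f = "fold (lin_op R) (map (\<lambda>y. x \<otimes> y) zs)"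
    \<comment> \<open>The outer induction hypothesis asks that \<open>v\<close> be annihilated by
      all of \<open>ys\<close>. This is why \<open>inner\<close> carries that assumption along while
      \<open>zs\<close> shrinks.\<close>
    have "?f (\<lambda>n. lin_op R x u n \<otimes> v (Suc n)) \<in> annihilated R rs"
      using annihilated_fold[OF rs xzs] Cons.prems
        \<open>\<And>v u. set xs \<subseteq> carrier R \<Longrightarrow> u \<in> annihilated R xs \<Longrightarrow> v \<in> annihilated R ys \<Longrightarrow>
           (\<lambda>n. u n \<otimes> v n) \<in> annihilated R (concat (map (\<lambda>x. map (\<lambda>y. x \<otimes> y) ys) xs))\<close>
        annihilated_Cons[OF Cons.prems(2) x] annihilated_shift xs
      unfolding rs_def by blast
    moreover have "?f (\<lambda>n. (x \<otimes> u n) \<otimes> lin_op R y v n) \<in> annihilated R rs"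
      using Cons.IH[OF zs annihilated_smult[OF _ x] annihilated_lin_op[OF assms(2) y]
        annihilated_Cons[OF _ y]] Cons.prems x xs by simp
    ultimately have "(\<lambda>n. ?f (\<lambda>n. lin_op R x u n \<otimes> v (Suc n)) n \<oplus>
        ?f (\<lambda>n. (x \<otimes> u n) \<otimes> lin_op R y v n) n) \<in> annihilated R rs"
      using annihilated_add[OF rs] by blast
    then show ?case
      using fold_lin_op_add[OF xzs seqs_mult[OF lin_op_closed[OF x u] seqs_shift[OF v]]
          seqs_mult[OF seqs_smult[OF x u] lin_op_closed[OF y v]]]
      by (simp add: lin_op_mult[OF x y u v])
  qed
  have xys: "set (map (\<lambda>y. x \<otimes> y) ys) \<subseteq> carrier R" using x assms(2) by auto
  have "(\<lambda>n. u n \<otimes> v n) \<in> annihilated R (map (\<lambda>y. x \<otimes> y) ys @ rs)"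
    using inner[OF assms(2) Cons.prems(2,3,3)] xys Cons.prems annihilated_closed
    by (simp add: annihilated_append[OF xys] seqs_mult)
  then show ?case by (simp add: rs_def)
qed

end

section \<open>The binomial transform\<close>

text \<open>
  The guard \<open>k \<le> n\<close> is needed because \<open>n - k\<close> is truncated to \<open>0\<close> and \<open>i choose 0 = 1\<close>.
\<close>

definition newton_weight :: "nat \<Rightarrow> nat \<Rightarrow> nat \<Rightarrow> nat" where
  "newton_weight n i k = (if k \<le> n then (n choose i) * (i choose (n - k)) else 0)"

text \<open>Moves a weight up by one index. It records a substitution of \<open>Suc k\<close> for
  \<open>k\<close> in the summand of a weighted sum; for generating polynomials it is multiplication
  by the variable.\<close>

definition pred_weight :: "(nat \<Rightarrow> nat) \<Rightarrow> nat \<Rightarrow> nat" where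
  "pred_weight w k = (case k of 0 \<Rightarrow> 0 | Suc j \<Rightarrow> w j)"

text \<open>\<open>newton_weight n i k\<close> is the coefficient of \<open>x^i y^k\<close> in
  \<open>(x + y + x y)^n = (x (1 + y) + y)^n\<close>. The three summands come from multiplying this
  power by \<open>x\<close>, by \<open>y\<close> and by \<open>x y\<close>.\<close>

lemma newton_weight_Suc:
  "newton_weight (Suc n) i k = pred_weight (\<lambda>i. newton_weight n i k) i
     + pred_weight (newton_weight n i) k
     + pred_weight (\<lambda>i. pred_weight (newton_weight n i) k) i"
proof (cases i)
  case 0
  then show ?thesis
    by (cases k) (auto simp: newton_weight_def pred_weight_def Suc_diff_le binomial_eq_0)
next
  case i: (Suc i')
  show ?thesis
  proof (cases k)
    case 0
    have "i' < n \<or> i' = n \<or> n < i'" by arith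
    then show ?thesis
      using i 0 by (elim disjE) (auto simp: newton_weight_def pred_weight_def binomial_eq_0)
  next
    case k: (Suc k')
    have "k' < n \<or> k' = n \<or> n < k'" by arith
    then show ?thesis
    proof (elim disjE)
      assume "k' < n"
      \<comment> \<open>This form of \<open>n\<close> removes the truncated subtractions:
        \<open>n - k'\<close> becomes \<open>Suc d\<close> and \<open>n - k\<close> becomes
        \<open>d\<close>, so Pascal's rule applies.\<close>
      then obtain d where "n = Suc (k' + d)" using less_iff_Suc_add by auto
      then show ?thesis
        using i k by (simp add: newton_weight_def pred_weight_def algebra_simps)
    qed (use i k in \<open>auto simp: newton_weight_def pred_weight_def\<close>)
  qed
qed

context cring
begin

lemma binomial_transform_closed: "u \<in> seqs R \<Longrightarrow> binomial_transform R u n \<in> carrier R"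
  by (induction n arbitrary: u) (auto simp: seqsD seqs_add seqs_shift)

lemma binomial_transform_add:
  "u \<in> seqs R \<Longrightarrow> v \<in> seqs R \<Longrightarrow>
    binomial_transform R (\<lambda>k. u k \<oplus> v k) n = binomial_transform R u n \<oplus> binomial_transform R v n"
proof (induction n arbitrary: u v)
  case (Suc n)
  have "(\<lambda>k. u k \<oplus> v k \<oplus> (u (Suc k) \<oplus> v (Suc k))) = (\<lambda>k. u k \<oplus> u (Suc k) \<oplus> (v k \<oplus> v (Suc k)))"
    using Suc.prems by (intro ext) (simp add: seqsD a_ac)
  then show ?case
    using Suc.IH[OF seqs_add[OF Suc.prems(1) seqs_shift[OF Suc.prems(1)]]
        seqs_add[OF Suc.prems(2) seqs_shift[OF Suc.prems(2)]]] by simp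
qed simp

lemma binomial_transform_smult:
  "u \<in> seqs R \<Longrightarrow> c \<in> carrier R \<Longrightarrow>
    binomial_transform R (\<lambda>k. c \<otimes> u k) n = c \<otimes> binomial_transform R u n"
proof (induction n arbitrary: u)
  case (Suc n)
  have "(\<lambda>k. c \<otimes> u k \<oplus> c \<otimes> u (Suc k)) = (\<lambda>k. c \<otimes> (u k \<oplus> u (Suc k)))"
    using Suc.prems by (intro ext) (simp add: seqsD r_distr)
  then show ?case
    using Suc.IH[OF seqs_add[OF Suc.prems(1) seqs_shift[OF Suc.prems(1)]] Suc.prems(2)] by simp
qed simp

lemma binomial_transform_zero: "binomial_transform R (\<lambda>k. \<zero>) n = \<zero>"
  by (induction n) auto

lemma binomial_transform_one: "binomial_transform R (\<lambda>k. if k = 0 then \<one> else \<zero>) n = \<one>"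
  by (induction n) (auto cong: if_cong)

text \<open>The transform turns the shift into "shift minus identity", so \<open>t - x\<close>
  becomes \<open>t - 1 - x\<close>.\<close>

lemma binomial_transform_lin_op:
  assumes "x \<in> carrier R" "u \<in> seqs R"
  shows "binomial_transform R (lin_op R x u) = lin_op R (\<one> \<oplus> x) (binomial_transform R u)"
proof
  fix n
  let ?T = "binomial_transform R"
  have 1: "?T u (Suc n) = ?T u n \<oplus> ?T (\<lambda>k. u (Suc k)) n"
    using binomial_transform_add[OF assms(2) seqs_shift[OF assms(2)]] by simp
  have "lin_op R x u = (\<lambda>k. u (Suc k) \<oplus> (\<ominus> x) \<otimes> u k)"
    using assms by (simp add: lin_op_def minus_eq l_minus seqsD)
  then have 2: "?T (lin_op R x u) n = ?T (\<lambda>k. u (Suc k)) n \<oplus> (\<ominus> x) \<otimes> ?T u n"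
    using assms by (simp add: binomial_transform_add binomial_transform_smult seqs_shift seqs_smult)
  show "?T (lin_op R x u) n = lin_op R (\<one> \<oplus> x) (?T u) n"
    unfolding 2 unfolding lin_op_def 1
    using assms binomial_transform_closed[OF assms(2), of n]
      binomial_transform_closed[OF seqs_shift[OF assms(2)], of n]
    by (simp add: l_distr minus_eq minus_add l_minus a_ac r_neg2 r_neg1)
qed

lemma binomial_transform_seqs: "u \<in> seqs R \<Longrightarrow> binomial_transform R u \<in> seqs R"
  by (simp add: seqs_def[of R] binomial_transform_closed seqsI)

lemma binomial_transform_fold_lin_op:
  "set xs \<subseteq> carrier R \<Longrightarrow> u \<in> seqs R \<Longrightarrow>
    binomial_transform R (fold (lin_op R) xs u) =
    fold (lin_op R) (map (\<lambda>x. \<one> \<oplus> x) xs) (binomial_transform R u)"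
  by (induction xs arbitrary: u) (auto simp: binomial_transform_lin_op lin_op_closed)

text \<open>The value at 0 is unchanged by the transform. For later values,
  \<open>lin_op R \<zero>\<close> is the shift, and the transform of the shifted sequence is again
  zero, so the induction passes to that sequence.\<close>

lemma binomial_transform_eq_zero:
  assumes "u \<in> seqs R" "binomial_transform R u = (\<lambda>n. \<zero>)"
  shows "u = (\<lambda>n. \<zero>)"
proof
  fix n
  show "u n = \<zero>"
    using assms
  proof (induction n arbitrary: u)
    case 0
    then show ?case by (metis binomial_transform.simps(1))
  next
    case (Suc n)
    have *: "u k = lin_op R \<zero> u (k - 1)" if "k > 0" for k
      using that Suc.prems(1) by (simp add: lin_op_def minus_eq seqsD)
    have "binomial_transform R (lin_op R \<zero> u) = (\<lambda>n. \<zero>)"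
      using binomial_transform_lin_op[OF zero_closed Suc.prems(1)] Suc.prems(2)
      by (simp add: lin_op_zero)
    then show ?case
      using Suc.IH[OF lin_op_closed[OF zero_closed Suc.prems(1)]] *[of "Suc n"] by simp
  qed
qed

lemma binomial_transform_inject:
  assumes "u \<in> seqs R" "v \<in> seqs R" "binomial_transform R u = binomial_transform R v"
  shows "u = v"
proof -
  let ?w = "\<lambda>n. u n \<oplus> (\<ominus> \<one>) \<otimes> v n"
  have "binomial_transform R ?w = (\<lambda>n. \<zero>)"
    using assms by (auto simp: binomial_transform_add binomial_transform_smult seqs_smult l_minus
        binomial_transform_closed r_neg)
  then have w: "?w = (\<lambda>n. \<zero>)"
    using binomial_transform_eq_zero assms by (simp add: seqs_add seqs_smult)
  show ?thesis
  proof
    fix n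
    show "u n = v n"
      using fun_cong[OF w, of n] seqsD[OF assms(1), of n] seqsD[OF assms(2), of n]
        r_right_minus_eq[of "u n" "v n"]
      by (simp add: l_minus minus_eq)
  qed
qed

text \<open>The transform intertwines the two operators and has trivial kernel, so annihilation can
  be tested on either side.\<close>

lemma annihilated_binomial_transform:
  assumes "set xs \<subseteq> carrier R" "u \<in> seqs R"
  shows "binomial_transform R u \<in> annihilated R (map (\<lambda>x. \<one> \<oplus> x) xs) \<longleftrightarrow> u \<in> annihilated R xs"
proof
  assume "binomial_transform R u \<in> annihilated R (map (\<lambda>x. \<one> \<oplus> x) xs)"
  then have "binomial_transform R (fold (lin_op R) xs u) = (\<lambda>n. \<zero>)"
    using assms by (simp add: binomial_transform_fold_lin_op annihilated_def)
  then show "u \<in> annihilated R xs"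
    using assms binomial_transform_eq_zero fold_lin_op_closed by (auto simp: annihilated_def)
next
  assume u: "u \<in> annihilated R xs"
  have "binomial_transform R (fold (lin_op R) xs u) = (\<lambda>n. \<zero>)"
    using u by (simp add: annihilated_def) (simp add: binomial_transform_zero fun_eq_iff)
  then show "binomial_transform R u \<in> annihilated R (map (\<lambda>x. \<one> \<oplus> x) xs)"
    using assms by (simp add: binomial_transform_fold_lin_op annihilated_def binomial_transform_seqs)
qed

section \<open>The Newton product as a weighted sum over a square, and its binomial
  transform\<close>

lemma finsum_extend:
  "n \<le> m \<Longrightarrow> f \<in> UNIV \<rightarrow> carrier R \<Longrightarrow> (\<And>k. n < k \<Longrightarrow> f k = \<zero>) \<Longrightarrow>
    (\<Oplus>k\<in>{..n::nat}. f k) = (\<Oplus>k\<in>{..m}. f k)"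
  by (rule add.finprod_mono_neutral_cong_left) auto

lemma finsum_pred_weight:
  assumes "f \<in> UNIV \<rightarrow> carrier R" "\<And>k. n < k \<Longrightarrow> w k = 0"
  shows "(\<Oplus>k\<in>{..n}. add_pow R (w k) (f (Suc k))) = (\<Oplus>k\<in>{..Suc n}. add_pow R (pred_weight w k) (f k))"
  using assms(1) by (subst finsum_Suc2) (auto simp: pred_weight_def Pi_iff)

text \<open>The index set no longer depends on \<open>n\<close> beyond \<open>n \<le> B\<close>, so
  values of the product at \<open>n\<close> and \<open>Suc n\<close> can be compared over one common
  square.\<close>

lemma newton_prod_box:
  assumes "a \<in> seqs R" "b \<in> seqs R" "n \<le> B"
  shows "newton_prod R a b n =
    (\<Oplus>i\<in>{..B}. \<Oplus>k\<in>{..B}. add_pow R (newton_weight n i k) (a i \<otimes> b k))"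
proof -
  note [simp] = seqsD[OF assms(1)] seqsD[OF assms(2)]
  have inner: "(\<Oplus>j\<in>{0..i}. add_pow R ((n choose i) * (i choose j)) (a i \<otimes> b (n - j))) =
    (\<Oplus>k\<in>{..B}. add_pow R (newton_weight n i k) (a i \<otimes> b k))" if "i \<le> n" for i
  proof -
    \<comment> \<open>The substitution \<open>k = n - j\<close> maps \<open>{0..i}\<close> onto
      \<open>{n - i..n}\<close>; outside that interval the weight vanishes.\<close>
    have inj: "inj_on (\<lambda>j. n - j) {0..i}" using that by (auto simp: inj_on_def)
    have img: "(\<lambda>j. n - j) ` {0..i} = {n - i..n}"
    proof (intro equalityI subsetI)
      fix x assume "x \<in> {n - i..n}"
      then have "x = n - (n - x)" "n - x \<in> {0..i}" using that by auto
      then show "x \<in> (\<lambda>j. n - j) ` {0..i}" by blast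
    qed (use that in auto)
    have "(\<Oplus>j\<in>{0..i}. add_pow R ((n choose i) * (i choose j)) (a i \<otimes> b (n - j))) =
      (\<Oplus>j\<in>{0..i}. add_pow R (newton_weight n i (n - j)) (a i \<otimes> b (n - j)))"
      using that by (intro finsum_cong') (auto simp: newton_weight_def)
    also have "\<dots> = (\<Oplus>k\<in>{n - i..n}. add_pow R (newton_weight n i k) (a i \<otimes> b k))"
      using finsum_reindex[OF _ inj, of "\<lambda>k. add_pow R (newton_weight n i k) (a i \<otimes> b k)"]
      by (simp add: img)
    also have "\<dots> = (\<Oplus>k\<in>{..B}. add_pow R (newton_weight n i k) (a i \<otimes> b k))"
      using assms(3) that
      by (intro add.finprod_mono_neutral_cong_left) (auto simp: newton_weight_def binomial_eq_0)
    finally show ?thesis .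
  qed
  have "newton_prod R a b n =
    (\<Oplus>i\<in>{..n}. \<Oplus>k\<in>{..B}. add_pow R (newton_weight n i k) (a i \<otimes> b k))"
    unfolding newton_prod_def
    by (rule finsum_cong') (auto simp: inner intro!: finsum_closed)
  also have "\<dots> = (\<Oplus>i\<in>{..B}. \<Oplus>k\<in>{..B}. add_pow R (newton_weight n i k) (a i \<otimes> b k))"
    using assms(3) by (intro finsum_extend)
      (auto simp: newton_weight_def binomial_eq_0 intro!: finsum_closed add.finprod_one_eqI)
  finally show ?thesis .
qed

lemma newton_prod_closed: "a \<in> seqs R \<Longrightarrow> b \<in> seqs R \<Longrightarrow> newton_prod R a b \<in> seqs R"
  by (auto simp: newton_prod_def seqsD intro!: seqsI finsum_closed)

text \<open>This is \<open>1 + (x + y + x y) = (1 + x) (1 + y)\<close>, with \<open>x\<close> and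
  \<open>y\<close> acting as the shifts of \<open>a\<close> and of \<open>b\<close>. It makes the
  Newton product compatible with one recursion step of \<open>binomial_transform\<close>.\<close>

lemma newton_prod_Suc:
  assumes "a \<in> seqs R" "b \<in> seqs R"
  shows "newton_prod R a b n \<oplus> newton_prod R a b (Suc n) =
    newton_prod R (\<lambda>k. a k \<oplus> a (Suc k)) (\<lambda>k. b k \<oplus> b (Suc k)) n"
proof -
  note [simp] = seqsD[OF assms(1)] seqsD[OF assms(2)]
  let ?d = "\<lambda>i k. a i \<otimes> b k" and ?w = "newton_weight n" and ?p = "add_pow R"
  let ?w1 = "\<lambda>i k. pred_weight (\<lambda>i. ?w i k) i"
  let ?w2 = "\<lambda>i. pred_weight (?w i)"
  let ?w3 = "\<lambda>i k. pred_weight (\<lambda>i. pred_weight (?w i) k) i"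
  let ?S = "\<lambda>n w d. \<Oplus>i\<in>{..n}. \<Oplus>k\<in>{..n}. ?p (w i k) (d i k)"
  have w0: "?w i k = 0" if "n < i \<or> n < k" for i k
    using that by (auto simp: newton_weight_def)
  have e0: "?S n ?w ?d = ?S (Suc n) ?w ?d"
    using newton_prod_box[OF assms, of n n] newton_prod_box[OF assms, of n "Suc n"] by simp
  \<comment> \<open>The sums \<open>e1\<close>, \<open>e2\<close>, \<open>e3\<close> belong to the
    terms \<open>x\<close>, \<open>y\<close>, \<open>x y\<close>. Each is enlarged to the square of
    side \<open>Suc n\<close>, either by a shift of an index or by adding terms of weight 0.\<close>
  have e1: "?S n ?w (\<lambda>i k. ?d (Suc i) k) = ?S (Suc n) ?w1 ?d"
  proof -
    have "?S n ?w (\<lambda>i k. ?d (Suc i) k) = (\<Oplus>i\<in>{..n}. \<Oplus>k\<in>{..Suc n}. ?p (?w i k) (?d (Suc i) k))"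
      by (intro finsum_cong' finsum_extend) (auto simp: w0 intro!: finsum_closed)
    also have "\<dots> = ?S (Suc n) ?w1 ?d"
      by (subst (3) finsum_Suc2) (auto simp: pred_weight_def intro!: finsum_closed)
    finally show ?thesis .
  qed
  have e2: "?S n ?w (\<lambda>i k. ?d i (Suc k)) = ?S (Suc n) ?w2 ?d"
  proof -
    have "?S n ?w (\<lambda>i k. ?d i (Suc k)) = (\<Oplus>i\<in>{..n}. \<Oplus>k\<in>{..Suc n}. ?p (?w2 i k) (?d i k))"
      by (intro finsum_cong' finsum_pred_weight) (auto simp: w0 intro!: finsum_closed)
    also have "\<dots> = ?S (Suc n) ?w2 ?d"
      by (intro finsum_extend)
        (auto simp: w0 pred_weight_def split: nat.split intro!: finsum_closed add.finprod_one_eqI)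
    finally show ?thesis .
  qed
  have e3: "?S n ?w (\<lambda>i k. ?d (Suc i) (Suc k)) = ?S (Suc n) ?w3 ?d"
  proof -
    have "?S n ?w (\<lambda>i k. ?d (Suc i) (Suc k)) =
        (\<Oplus>i\<in>{..n}. \<Oplus>k\<in>{..Suc n}. ?p (?w2 i k) (?d (Suc i) k))"
      by (intro finsum_cong' finsum_pred_weight) (auto simp: w0 intro!: finsum_closed)
    also have "\<dots> = ?S (Suc n) ?w3 ?d"
      by (subst (3) finsum_Suc2) (auto simp: pred_weight_def intro!: finsum_closed)
    finally show ?thesis .
  qed
  have "newton_prod R a b (Suc n) = ?S (Suc n) (\<lambda>i k. ?w1 i k + ?w2 i k + ?w3 i k) ?d"
    using newton_prod_box[OF assms, of "Suc n" "Suc n"] by (simp only: newton_weight_Suc)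
  also have "\<dots> = (\<Oplus>i\<in>{..Suc n}. \<Oplus>k\<in>{..Suc n}.
      ?p (?w1 i k) (?d i k) \<oplus> ?p (?w2 i k) (?d i k) \<oplus> ?p (?w3 i k) (?d i k))"
    by (intro finsum_cong') (auto simp: add.nat_pow_mult[symmetric] intro!: finsum_closed)
  also have "\<dots> = ?S (Suc n) ?w1 ?d \<oplus> ?S (Suc n) ?w2 ?d \<oplus> ?S (Suc n) ?w3 ?d"
    by (simp add: finsum_addf Pi_iff finsum_closed del: finsum_Suc)
  finally have s: "newton_prod R a b (Suc n) = ?S n ?w (\<lambda>i k. ?d (Suc i) k) \<oplus>
      ?S n ?w (\<lambda>i k. ?d i (Suc k)) \<oplus> ?S n ?w (\<lambda>i k. ?d (Suc i) (Suc k))"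
    by (simp only: e1 e2 e3)
  have "newton_prod R (\<lambda>k. a k \<oplus> a (Suc k)) (\<lambda>k. b k \<oplus> b (Suc k)) n =
    ?S n ?w (\<lambda>i k. (a i \<oplus> a (Suc i)) \<otimes> (b k \<oplus> b (Suc k)))"
    using assms by (intro newton_prod_box) (auto simp: seqs_add seqs_shift)
  also have "\<dots> = (\<Oplus>i\<in>{..n}. \<Oplus>k\<in>{..n}. ?p (?w i k) (?d i k) \<oplus> (?p (?w i k) (?d (Suc i) k) \<oplus>
      ?p (?w i k) (?d i (Suc k)) \<oplus> ?p (?w i k) (?d (Suc i) (Suc k))))"
    by (intro finsum_cong') (auto simp: add.nat_pow_distrib[symmetric] l_distr r_distr a_ac intro!: finsum_closed)
  also have "\<dots> = ?S n ?w ?d \<oplus> (?S n ?w (\<lambda>i k. ?d (Suc i) k) \<oplus>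
      ?S n ?w (\<lambda>i k. ?d i (Suc k)) \<oplus> ?S n ?w (\<lambda>i k. ?d (Suc i) (Suc k)))"
    by (simp add: finsum_addf Pi_iff finsum_closed)
  finally show ?thesis
    using newton_prod_box[OF assms, of n n] s by simp
qed

text \<open>By \<open>newton_prod_Suc\<close> one step of the recursion replaces both factors by
  "identity plus shift" applied to them, which is also the recursion step on the right; at index 0
  both sides are \<open>a 0 \<otimes> b 0\<close>.\<close>

lemma binomial_transform_newton_prod:
  assumes "a \<in> seqs R" "b \<in> seqs R"
  shows "binomial_transform R (newton_prod R a b) n =
    binomial_transform R a n \<otimes> binomial_transform R b n"
  using assms
proof (induction n arbitrary: a b)
  case 0
  then show ?case by (simp add: newton_prod_def seqsD)
next
  case (Suc n)
  then show ?case by (simp add: newton_prod_Suc seqs_add seqs_shift)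
qed

text \<open>After the transform the roots are \<open>1 + x\<close> and \<open>1 + y\<close>, and
  their product is \<open>1 + (x + y + x y)\<close>; undoing the transform removes the 1.\<close>

lemma annihilated_newton_prod:
  assumes "set xs \<subseteq> carrier R" "set ys \<subseteq> carrier R" "a \<in> annihilated R xs" "b \<in> annihilated R ys"
  shows "newton_prod R a b \<in>
    annihilated R (concat (map (\<lambda>x. map (\<lambda>y. x \<oplus> y \<oplus> x \<otimes> y) ys) xs))" (is "_ \<in> annihilated R ?zs")
proof -
  let ?T = "binomial_transform R"
  note ab = assms(3,4)[THEN annihilated_closed]
  have zs: "set ?zs \<subseteq> carrier R" using assms by (auto simp: subset_iff)
  have "map (\<lambda>x. \<one> \<oplus> x) ?zs =
      concat (map (\<lambda>x. map (\<lambda>y. x \<otimes> y) (map (\<lambda>y. \<one> \<oplus> y) ys)) (map (\<lambda>x. \<one> \<oplus> x) xs))"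
    using assms(1,2)
    by (auto simp: map_concat comp_def l_distr r_distr a_ac subset_iff intro!: arg_cong[of _ _ concat] map_cong)
  moreover have "(\<lambda>n. ?T a n \<otimes> ?T b n) \<in> annihilated R
      (concat (map (\<lambda>x. map (\<lambda>y. x \<otimes> y) (map (\<lambda>y. \<one> \<oplus> y) ys)) (map (\<lambda>x. \<one> \<oplus> x) xs)))"
    using assms ab by (intro annihilated_mult) (auto simp: annihilated_binomial_transform)
  moreover have "?T (newton_prod R a b) = (\<lambda>n. ?T a n \<otimes> ?T b n)"
    using ab by (simp add: binomial_transform_newton_prod fun_eq_iff)
  ultimately show ?thesis
    using annihilated_binomial_transform[OF zs newton_prod_closed[OF ab]] by simp
qed

end

section \<open>Polynomials with coefficients in a subring\<close>

text \<open>The polynomials over the subring \<open>X\<close> are kept as a subset of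
  \<open>UP R\<close>, so that sums and products over \<open>X\<close> and over \<open>R\<close> are
  literally the same.\<close>

definition polys_over :: "('a, 'm) ring_scheme \<Rightarrow> 'a set \<Rightarrow> (nat \<Rightarrow> 'a) set" where
  "polys_over R X = {f \<in> carrier (UP R). \<forall>k. f k \<in> X}"

text \<open>Phrased by coefficients, with \<open>N\<close> as a parameter, so that the zero ring,
  where the polynomial does not determine \<open>N\<close>, is treated uniformly.\<close>

definition monic_of_degree :: "('a, 'm) ring_scheme \<Rightarrow> nat \<Rightarrow> (nat \<Rightarrow> 'a) \<Rightarrow> bool" where
  "monic_of_degree R N p \<longleftrightarrow>
     p \<in> carrier (UP R) \<and> p N = \<one>\<^bsub>R\<^esub> \<and> (\<forall>k>N. p k = \<zero>\<^bsub>R\<^esub>)"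

context cring
begin

lemma subring_finsum_closed:
  "subring X R \<Longrightarrow> (\<And>i. i \<in> A \<Longrightarrow> f i \<in> X) \<Longrightarrow> (\<Oplus>i\<in>A. f i) \<in> X"
proof (induction A rule: infinite_finite_induct)
  case (insert x F)
  have "f \<in> insert x F \<rightarrow> carrier R" using insert.prems subringE(1) by blast
  then show ?case using insert subringE(7)[OF insert.prems(1)] by simp
qed (auto simp: subringE(2))

lemma subring_nat_pow_closed: "subring X R \<Longrightarrow> x \<in> X \<Longrightarrow> x [^] (n::nat) \<in> X"
  by (induction n) (auto simp: subringE(3,6))

text \<open>The product of the \<open>u - b v\<close> is the homogenization of the product of the
  \<open>t - b\<close>, evaluated at \<open>(u, v)\<close>. The right side depends on
  \<open>bs\<close> only through its coefficients and its length.\<close>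

lemma foldr_linear_eq_sum:
  assumes "u \<in> carrier R" "v \<in> carrier R" "set bs \<subseteq> carrier R"
  shows "foldr (\<lambda>b r. (u \<ominus> b \<otimes> v) \<otimes> r) bs \<one> =
    (\<Oplus>k\<in>{..length bs}. root_coeffs R bs k \<otimes> (u [^] k \<otimes> v [^] (length bs - k)))"
  using assms(3)
proof (induction bs)
  case Nil
  then show ?case by simp
next
  case (Cons b bs)
  let ?n = "length bs" and ?c = "root_coeffs R bs"
  have bs: "set bs \<subseteq> carrier R" and b: "b \<in> carrier R" using Cons.prems by auto
  note [simp] = root_coeffs_closed[OF bs] b assms(1,2)
  define c' where "c' = (\<lambda>k. case k of 0 \<Rightarrow> \<zero> | Suc j \<Rightarrow> ?c j)"
  have c'_0: "c' 0 = \<zero>" and c'_Suc: "c' (Suc j) = ?c j" for j by (simp_all add: c'_def)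
  have [simp]: "c' k \<in> carrier R" for k by (auto simp: c'_def split: nat.split)
  let ?m = "\<lambda>k. u [^] k \<otimes> v [^] (Suc ?n - k)"
  \<comment> \<open>Multiplication by \<open>u\<close> raises the index of the coefficient, whereas
    multiplication by \<open>v\<close> keeps it and raises the complementary exponent.\<close>
  have 1: "(\<Oplus>k\<in>{..?n}. u \<otimes> (?c k \<otimes> (u [^] k \<otimes> v [^] (?n - k)))) = (\<Oplus>k\<in>{..Suc ?n}. c' k \<otimes> ?m k)"
    by (subst finsum_Suc2) (auto simp: c'_0 c'_Suc m_ac intro!: finsum_cong')
  have 2: "(\<Oplus>k\<in>{..?n}. v \<otimes> (?c k \<otimes> (u [^] k \<otimes> v [^] (?n - k)))) = (\<Oplus>k\<in>{..Suc ?n}. ?c k \<otimes> ?m k)"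
    by (simp add: root_coeffs_above[OF bs])
      (auto simp: Suc_diff_le m_ac intro!: finsum_cong')
  have "foldr (\<lambda>b r. (u \<ominus> b \<otimes> v) \<otimes> r) (b # bs) \<one> =
    (u \<ominus> b \<otimes> v) \<otimes> (\<Oplus>k\<in>{..?n}. ?c k \<otimes> (u [^] k \<otimes> v [^] (?n - k)))"
    using Cons.IH[OF bs] by simp
  also have "\<dots> = u \<otimes> (\<Oplus>k\<in>{..?n}. ?c k \<otimes> (u [^] k \<otimes> v [^] (?n - k))) \<oplus>
      (\<ominus> b) \<otimes> (v \<otimes> (\<Oplus>k\<in>{..?n}. ?c k \<otimes> (u [^] k \<otimes> v [^] (?n - k))))"
    by (simp add: minus_eq l_distr l_minus m_assoc finsum_closed)
  also have "\<dots> = (\<Oplus>k\<in>{..Suc ?n}. c' k \<otimes> ?m k) \<oplus> (\<ominus> b) \<otimes> (\<Oplus>k\<in>{..Suc ?n}. ?c k \<otimes> ?m k)"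
    using 1 2 by (simp add: finsum_rdistr del: finsum_Suc)
  also have "\<dots> = (\<Oplus>k\<in>{..Suc ?n}. c' k \<otimes> ?m k \<oplus> (\<ominus> b) \<otimes> (?c k \<otimes> ?m k))"
    by (subst finsum_rdistr) (auto simp: finsum_addf simp del: finsum_Suc)
  also have "\<dots> = (\<Oplus>k\<in>{..Suc ?n}. root_coeffs R (b # bs) k \<otimes> ?m k)"
    by (rule finsum_cong') (auto simp: minus_eq l_distr l_minus m_assoc c'_def[symmetric])
  finally show ?case by simp
qed

end

lemma root_coeffs_hom:
  assumes "cring R" "cring S" "\<phi> \<in> ring_hom R S" "set xs \<subseteq> carrier R"
  shows "root_coeffs S (map \<phi> xs) k = \<phi> (root_coeffs R xs k)"
proof -
  interpret ring_hom_cring R S \<phi>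
    using assms by (simp add: ring_hom_cring_def ring_hom_cring_axioms_def)
  show ?thesis
    using assms(4)
    by (induction xs arbitrary: k)
      (auto simp: R.minus_eq S.minus_eq R.root_coeffs_closed split: nat.split)
qed

section \<open>Polynomials as coefficient functions, and products of linear factors\<close>

context UP_cring
begin

lemma coeff_eq: "p \<in> carrier P \<Longrightarrow> coeff P p k = p k"
  by (simp add: P_def UP_def)

lemma carrier_eqI:
  "p \<in> carrier P \<Longrightarrow> q \<in> carrier P \<Longrightarrow> (\<And>k. p k = q k) \<Longrightarrow> p = q"
  by auto

lemma carrierI:
  assumes "\<And>k. p k \<in> carrier R" "\<And>k. N < k \<Longrightarrow> p k = \<zero>"
  shows "p \<in> carrier P"
  using assms by (auto simp: P_def UP_def bound_def)

lemma carrier_bound: "p \<in> carrier P \<Longrightarrow> \<exists>n. \<forall>k\<ge>n. p k = \<zero>"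
  by (auto simp: P_def UP_def up_def bound_def) (metis Suc_le_eq)

lemma carrier_nth: "p \<in> carrier P \<Longrightarrow> p k \<in> carrier R"
  by (auto simp: P_def UP_def)

lemma add_nth: "p \<in> carrier P \<Longrightarrow> q \<in> carrier P \<Longrightarrow> (p \<oplus>\<^bsub>P\<^esub> q) k = p k \<oplus> q k"
  using coeff_add[of p q k] by (simp add: coeff_eq)

lemma uminus_nth: "p \<in> carrier P \<Longrightarrow> (\<ominus>\<^bsub>P\<^esub> p) k = \<ominus> p k"
  using coeff_a_inv[of p k] by (simp add: coeff_eq)

lemma minus_nth: "p \<in> carrier P \<Longrightarrow> q \<in> carrier P \<Longrightarrow> (p \<ominus>\<^bsub>P\<^esub> q) k = p k \<ominus> q k"
  by (simp add: a_minus_def add_nth uminus_nth)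

lemma mult_nth:
  "p \<in> carrier P \<Longrightarrow> q \<in> carrier P \<Longrightarrow> (p \<otimes>\<^bsub>P\<^esub> q) k = (\<Oplus>i\<in>{..k}. p i \<otimes> q (k - i))"
  using coeff_mult[of p q k] by (simp add: coeff_eq)

lemma one_nth: "\<one>\<^bsub>P\<^esub> k = (if k = 0 then \<one> else \<zero>)"
  using coeff_one[of k, unfolded coeff_eq[OF UP_one_closed]] .

lemma zero_nth: "\<zero>\<^bsub>P\<^esub> k = \<zero>"
  using coeff_zero[of k, unfolded coeff_eq[OF UP_zero_closed]] .

lemma monom_nth: "a \<in> carrier R \<Longrightarrow> monom P a m k = (if m = k then a else \<zero>)"
  using coeff_monom[of a m k] by (simp add: coeff_eq)

lemma monom_mult_nth:
  assumes "a \<in> carrier R" "p \<in> carrier P"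
  shows "(monom P a m \<otimes>\<^bsub>P\<^esub> p) k = (if m \<le> k then a \<otimes> p (k - m) else \<zero>)"
proof -
  note [simp] = carrier_nth[OF assms(2)] assms(1)
  have "(monom P a m \<otimes>\<^bsub>P\<^esub> p) k = (\<Oplus>i\<in>{..k}. monom P a m i \<otimes> p (k - i))"
    using assms by (simp add: mult_nth)
  also have "\<dots> = (\<Oplus>i\<in>{..k}. if m = i then a \<otimes> p (k - i) else \<zero>)"
    by (rule R.finsum_cong') (auto simp: monom_nth)
  also have "\<dots> = (if m \<le> k then a \<otimes> p (k - m) else \<zero>)"
    using R.finsum_singleton[of m "{..k}" "\<lambda>i. a \<otimes> p (k - i)"]
    by (auto intro!: R.add.finprod_one_eqI)
  finally show ?thesis .
qed

lemma lin_factor_closed: "x \<in> carrier R \<Longrightarrow> lin_factor R x \<in> carrier P"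
  unfolding lin_factor_def P_def[symmetric] using UP_ring by (simp add: ring.ring_simprules)

lemma lin_factor_mult_nth:
  assumes "x \<in> carrier R" "p \<in> carrier P"
  shows "(lin_factor R x \<otimes>\<^bsub>P\<^esub> p) k = (case k of 0 \<Rightarrow> \<zero> | Suc j \<Rightarrow> p j) \<ominus> x \<otimes> p k"
proof -
  interpret P: cring P by (rule UP_cring)
  have "lin_factor R x \<otimes>\<^bsub>P\<^esub> p = monom P \<one> 1 \<otimes>\<^bsub>P\<^esub> p \<ominus>\<^bsub>P\<^esub> monom P x 0 \<otimes>\<^bsub>P\<^esub> p"
    unfolding lin_factor_def P_def[symmetric] using assms
    by (simp add: P.minus_eq P.l_distr P.l_minus)
  then show ?thesis
    using assms carrier_nth[OF assms(2)]
    by (simp add: minus_nth monom_mult_nth split: nat.split)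
qed

lemma root_coeffs_in_carrier: "set xs \<subseteq> carrier R \<Longrightarrow> root_coeffs R xs \<in> carrier P"
  by (rule carrierI[where N = "length xs"]) (auto simp: R.root_coeffs_closed R.root_coeffs_above)

lemma root_coeffs_Nil: "root_coeffs R [] = \<one>\<^bsub>P\<^esub>"
  by (rule ext) (simp add: one_nth)

lemma root_coeffs_Cons:
  "x \<in> carrier R \<Longrightarrow> set xs \<subseteq> carrier R \<Longrightarrow>
    root_coeffs R (x # xs) = lin_factor R x \<otimes>\<^bsub>P\<^esub> root_coeffs R xs"
  by (rule ext) (simp add: lin_factor_mult_nth root_coeffs_in_carrier)

lemma root_coeffs_append:
  "set xs \<subseteq> carrier R \<Longrightarrow> set ys \<subseteq> carrier R \<Longrightarrow>
    root_coeffs R (xs @ ys) = root_coeffs R xs \<otimes>\<^bsub>P\<^esub> root_coeffs R ys"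
  by (induction xs)
    (auto simp: root_coeffs_Nil root_coeffs_Cons root_coeffs_in_carrier lin_factor_closed UP_m_assoc
      simp del: root_coeffs.simps)

lemma finprod_root_coeffs:
  assumes "\<And>i. i \<in> {1..N} \<Longrightarrow> set (f i) \<subseteq> carrier R"
  shows "(\<Otimes>\<^bsub>P\<^esub>i\<in>{1..N}. root_coeffs R (f i)) = root_coeffs R (concat (map f [1..<Suc N]))"
  using assms
proof (induction N)
  case 0
  interpret P: cring P by (rule UP_cring)
  show ?case by (simp add: root_coeffs_Nil del: root_coeffs.simps)
next
  case (Suc N)
  interpret P: cring P by (rule UP_cring)
  have 1: "{1..Suc N} = insert (Suc N) {1..N}" by auto
  have f: "set (f i) \<subseteq> carrier R" if "1 \<le> i" "i \<le> Suc N" for i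
    using Suc.prems that by simp
  have 2: "set (concat (map f [1..<Suc N])) \<subseteq> carrier R"
  proof
    fix x assume "x \<in> set (concat (map f [1..<Suc N]))"
    then obtain i where "1 \<le> i" "i \<le> N" "x \<in> set (f i)" by auto
    then show "x \<in> carrier R" using f[of i] by auto
  qed
  have "(\<Otimes>\<^bsub>P\<^esub>i\<in>{1..Suc N}. root_coeffs R (f i)) =
    root_coeffs R (f (Suc N)) \<otimes>\<^bsub>P\<^esub> (\<Otimes>\<^bsub>P\<^esub>i\<in>{1..N}. root_coeffs R (f i))"
    unfolding 1 by (subst P.finprod_insert) (simp_all add: Pi_iff root_coeffs_in_carrier f)
  \<comment> \<open>\<open>finprod_insert\<close> puts the new factor in front, while the list has
    it at the end.\<close>
  also have "\<dots> = root_coeffs R (concat (map f [1..<Suc N])) \<otimes>\<^bsub>P\<^esub> root_coeffs R (f (Suc N))"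
    using Suc.IH f 2 by (simp add: P.m_comm P.finprod_closed root_coeffs_in_carrier)
  also have "\<dots> = root_coeffs R (concat (map f [1..<Suc (Suc N)]))"
    using 2 f by (simp add: root_coeffs_append)
  finally show ?case .
qed

lemma root_coeffs_single: "x \<in> carrier R \<Longrightarrow> root_coeffs R [x] = lin_factor R x"
  by (simp add: root_coeffs_Cons root_coeffs_Nil lin_factor_closed UP_r_one del: root_coeffs.simps)

lemma finprod_lin_factor:
  assumes "\<alpha> \<in> {1..N} \<rightarrow> carrier R"
  shows "(\<Otimes>\<^bsub>P\<^esub>i\<in>{1..N}. lin_factor R (\<alpha> i)) = root_coeffs R (map \<alpha> [1..<Suc N])"
proof -
  interpret P: cring P by (rule UP_cring)
  have "(\<Otimes>\<^bsub>P\<^esub>i\<in>{1..N}. lin_factor R (\<alpha> i)) = (\<Otimes>\<^bsub>P\<^esub>i\<in>{1..N}. root_coeffs R [\<alpha> i])"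
    using assms
    by (intro P.finprod_cong')
      (auto simp: root_coeffs_single lin_factor_closed Pi_iff simp del: root_coeffs.simps)
  also have "\<dots> = root_coeffs R (map \<alpha> [1..<Suc N])"
    using finprod_root_coeffs[of N "\<lambda>i. [\<alpha> i]"] assms by (auto simp: concat_map_singleton Pi_iff)
  finally show ?thesis .
qed

section \<open>Division by monic polynomials over a subring\<close>

lemma polys_over_subring:
  assumes "subring X R"
  shows "subring (polys_over R X) P"
proof -
  interpret P: cring P by (rule UP_cring)
  note X = subringE[OF assms]
  show ?thesis
    unfolding polys_over_def P_def[symmetric]
    by (rule P.subringI)
      (use X in \<open>auto simp: one_nth uminus_nth mult_nth add_nth intro!: R.subring_finsum_closed[OF assms]\<close>)
qed

text \<open>Each step of long division by a monic \<open>p\<close> subtracts a multiple of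
  \<open>p\<close> whose factor is a coefficient of the current dividend. Nothing is inverted, so
  quotient and remainder stay over \<open>X\<close>.\<close>

lemma division_by_monic:
  assumes "subring X R" "p \<in> polys_over R X" "p N = \<one>" "\<And>k. N < k \<Longrightarrow> p k = \<zero>"
    and "f \<in> polys_over R X"
  shows "\<exists>q\<in>polys_over R X. \<exists>r\<in>polys_over R X. f = p \<otimes>\<^bsub>P\<^esub> q \<oplus>\<^bsub>P\<^esub> r \<and> (\<forall>k\<ge>N. r k = \<zero>)"
proof -
  interpret P: cring P by (rule UP_cring)
  note K = subringE[OF polys_over_subring[OF assms(1)]]
  have X: "X \<subseteq> carrier R" and "\<zero> \<in> X" using subringE[OF assms(1)] by auto
  have pP: "p \<in> carrier P" using assms(2) K by auto
  have *: "\<exists>q\<in>polys_over R X. \<exists>r\<in>polys_over R X. f = p \<otimes>\<^bsub>P\<^esub> q \<oplus>\<^bsub>P\<^esub> r \<and> (\<forall>k\<ge>N. r k = \<zero>)"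
    if "f \<in> polys_over R X" "\<forall>k\<ge>n. f k = \<zero>" for n f
    using that
  proof (induction n arbitrary: f)
    case 0
    have fP: "f \<in> carrier P" using "0.prems"(1) K(1) by blast
    have "\<forall>k\<ge>N. f k = \<zero>" using "0.prems"(2) by simp
    then show ?case
      using "0.prems"(1) K(2) fP pP
      by (intro bexI[of _ "\<zero>\<^bsub>P\<^esub>"] bexI[of _ f] conjI) simp_all
  next
    case (Suc m)
    have fP: "f \<in> carrier P" using Suc.prems K by auto
    show ?case
    proof (cases "m < N")
      case True
      then show ?thesis
        using K pP fP Suc.prems by (intro bexI[of _ "\<zero>\<^bsub>P\<^esub>"] bexI[of _ f]) auto
    next
      case False
      have fm: "f m \<in> X" using Suc.prems by (auto simp: polys_over_def)
      then have fm': "f m \<in> carrier R" using X by auto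
      let ?t = "monom P (f m) (m - N)"
      have tK: "?t \<in> polys_over R X"
        using fm' fm \<open>\<zero> \<in> X\<close> by (auto simp: polys_over_def P_def[symmetric] monom_nth)
      have tP: "?t \<in> carrier P" using tK K by auto
      let ?f = "f \<ominus>\<^bsub>P\<^esub> ?t \<otimes>\<^bsub>P\<^esub> p"
      have "?f \<in> polys_over R X"
        unfolding a_minus_def by (rule K(7)[OF Suc.prems(1) K(5)[OF K(6)[OF tK assms(2)]]])
      \<comment> \<open>At \<open>m\<close> the terms cancel because \<open>p N = \<one>\<close>;
        above \<open>m\<close> both \<open>f\<close> and the shifted \<open>p\<close>
        vanish.\<close>
      moreover have "?f k = \<zero>" if "k \<ge> m" for k
      proof (cases "k = m")
        case True
        then show ?thesis
          using False fP pP tP fm' assms(3)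
          by (simp add: minus_nth monom_mult_nth R.r_neg R.minus_eq)
      next
        case k: False
        then have "N < k - (m - N)" "f k = \<zero>" using that False Suc.prems(2) by auto
        then show ?thesis
          using False fP pP tP fm' assms(4)
          by (simp add: minus_nth monom_mult_nth R.minus_eq)
      qed
      ultimately obtain q r where qr: "q \<in> polys_over R X" "r \<in> polys_over R X"
        "?f = p \<otimes>\<^bsub>P\<^esub> q \<oplus>\<^bsub>P\<^esub> r" "\<forall>k\<ge>N. r k = \<zero>"
        using Suc.IH[of ?f] by blast
      have qP: "q \<in> carrier P" "r \<in> carrier P" using qr K by auto
      have "f = ?f \<oplus>\<^bsub>P\<^esub> ?t \<otimes>\<^bsub>P\<^esub> p"
        using fP pP tP by (simp add: P.minus_eq P.a_assoc P.l_neg)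
      also have "\<dots> = p \<otimes>\<^bsub>P\<^esub> (q \<oplus>\<^bsub>P\<^esub> ?t) \<oplus>\<^bsub>P\<^esub> r"
        unfolding qr(3) using qP pP tP by (simp add: P.r_distr P.a_ac P.m_comm)
      finally show ?thesis using qr K tK by (intro bexI[of _ "q \<oplus>\<^bsub>P\<^esub> ?t"] bexI[of _ r]) auto
    qed
  qed
  have "f \<in> carrier P" using assms(5) K by auto
  then obtain n where "\<forall>k\<ge>n. f k = \<zero>" using carrier_bound by blast
  then show ?thesis using *[OF assms(5)] by blast
qed

text \<open>The top coefficient of \<open>q\<close> reappears, times 1, in the product at an index
  at least \<open>N\<close>, even if \<open>R\<close> has zero divisors. This gives the uniqueness
  of remainders modulo \<open>p\<close>.\<close>

lemma monic_mult_eq_zero: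
  assumes "p \<in> carrier P" "p N = \<one>" "\<And>k. N < k \<Longrightarrow> p k = \<zero>"
    and "q \<in> carrier P" "\<And>k. N \<le> k \<Longrightarrow> (p \<otimes>\<^bsub>P\<^esub> q) k = \<zero>"
  shows "q = \<zero>\<^bsub>P\<^esub>"
proof -
  note [simp] = carrier_nth[OF assms(1)] carrier_nth[OF assms(4)]
  obtain n where "\<forall>k\<ge>n. q k = \<zero>" using carrier_bound assms(4) by blast
  then have "\<forall>k. q k = \<zero>"
  proof (induction n)
    case (Suc m)
    have "\<zero> = (\<Oplus>i\<in>{..m + N}. p i \<otimes> q (m + N - i))"
      using assms(5)[of "m + N"] assms(1,4) by (simp add: mult_nth)
    also have "\<dots> = (\<Oplus>i\<in>{..m + N}. if N = i then q (m + N - i) else \<zero>)"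
    proof (rule R.finsum_cong')
      fix i assume "i \<in> {..m + N}"
      have "i < N \<or> i = N \<or> N < i" by arith
      then show "p i \<otimes> q (m + N - i) = (if N = i then q (m + N - i) else \<zero>)"
        using Suc.prems assms(2,3) by auto
    qed auto
    also have "\<dots> = q m"
      using R.finsum_singleton[of N "{..m + N}" "\<lambda>i. q (m + N - i)"] by simp
    finally show ?case using Suc by (metis not_less_eq_eq le_antisym)
  qed simp
  then show ?thesis using assms(4) by (intro carrier_eqI) (auto simp: zero_nth)
qed

end

section \<open>Polynomials with roots \<open>x + y + x y\<close>\<close>

text \<open>The circle operation \<open>x + y + x y = (1 + x) (1 + y) - 1\<close>, taken over all
  pairs, with \<open>xs\<close> as the outer loop.\<close>

definition circle_roots :: "('a, 'm) ring_scheme \<Rightarrow> 'a list \<Rightarrow> 'a list \<Rightarrow> 'a list" where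
  "circle_roots R xs ys =
     concat (map (\<lambda>x. map (\<lambda>y. x \<oplus>\<^bsub>R\<^esub> y \<oplus>\<^bsub>R\<^esub> x \<otimes>\<^bsub>R\<^esub> y) ys) xs)"

context cring
begin

lemma circle_roots_closed:
  "set xs \<subseteq> carrier R \<Longrightarrow> set ys \<subseteq> carrier R \<Longrightarrow> set (circle_roots R xs ys) \<subseteq> carrier R"
  by (auto simp: circle_roots_def subset_iff)

end

lemma circle_roots_hom:
  assumes "\<phi> \<in> ring_hom R S" "cring R" "set xs \<subseteq> carrier R" "set ys \<subseteq> carrier R"
  shows "map \<phi> (circle_roots R xs ys) = circle_roots S (map \<phi> xs) (map \<phi> ys)"
proof -
  interpret cring R by fact
  show ?thesis
    using assms(3,4)
    by (auto simp: circle_roots_def map_concat comp_def subset_iff ring_hom_add[OF assms(1)]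
        ring_hom_mult[OF assms(1)] intro!: arg_cong[of _ _ concat] map_cong)
qed

context UP_cring
begin

lemma lin_factor_nth:
  "x \<in> carrier R \<Longrightarrow> lin_factor R x k = (if k = 0 then \<ominus> x else if k = 1 then \<one> else \<zero>)"
  unfolding lin_factor_def P_def[symmetric] by (simp add: minus_nth monom_nth R.minus_eq)

lemma lin_factor_circle:
  assumes "x \<in> carrier R" "y \<in> carrier R"
  shows "lin_factor R (x \<oplus> y \<oplus> x \<otimes> y) =
    lin_factor R x \<ominus>\<^bsub>P\<^esub> monom P y 0 \<otimes>\<^bsub>P\<^esub> monom P (\<one> \<oplus> x) 0"
  using assms
  by (intro ext) (simp add: lin_factor_nth minus_nth lin_factor_closed monom_mult_nth monom_nth
      R.minus_eq R.r_distr R.minus_add R.a_ac R.m_comm del: monom_add)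

lemma root_coeffs_circle_eq_foldr:
  assumes "x \<in> carrier R" "set bs \<subseteq> carrier R"
  shows "root_coeffs R (map (\<lambda>y. x \<oplus> y \<oplus> x \<otimes> y) bs) =
    foldr (\<lambda>b r. (lin_factor R x \<ominus>\<^bsub>P\<^esub> b \<otimes>\<^bsub>P\<^esub> monom P (\<one> \<oplus> x) 0) \<otimes>\<^bsub>P\<^esub> r)
      (map (\<lambda>b. monom P b 0) bs) \<one>\<^bsub>P\<^esub>"
  using assms(2)
proof (induction bs)
  case Nil
  then show ?case by (simp add: root_coeffs_Nil del: root_coeffs.simps)
next
  case (Cons b bs)
  have "set (map (\<lambda>y. x \<oplus> y \<oplus> x \<otimes> y) bs) \<subseteq> carrier R" using Cons.prems assms(1) by auto
  then show ?case
    using Cons assms(1)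
    by (simp add: root_coeffs_Cons lin_factor_circle del: root_coeffs.simps monom_add)
qed

text \<open>\<open>foldr_linear_eq_sum\<close> in the polynomial ring, with \<open>u = t - x\<close>
  and \<open>v = 1 + x\<close>. For a fixed \<open>x\<close> the block of the double product sees
  \<open>bs\<close> only through the coefficients of its polynomial.\<close>

lemma root_coeffs_circle:
  assumes "x \<in> carrier R" "set bs \<subseteq> carrier R"
  shows "root_coeffs R (map (\<lambda>y. x \<oplus> y \<oplus> x \<otimes> y) bs) =
    (\<Oplus>\<^bsub>P\<^esub>k\<in>{..length bs}. monom P (root_coeffs R bs k) 0 \<otimes>\<^bsub>P\<^esub>
      (lin_factor R x [^]\<^bsub>P\<^esub> k \<otimes>\<^bsub>P\<^esub> monom P (\<one> \<oplus> x) 0 [^]\<^bsub>P\<^esub> (length bs - k)))"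
proof -
  interpret P: cring P by (rule UP_cring)
  have "set (map (\<lambda>b. monom P b 0) bs) \<subseteq> carrier P" using assms by auto
  moreover have "root_coeffs P (map (\<lambda>b. monom P b 0) bs) k = monom P (root_coeffs R bs k) 0" for k
    using root_coeffs_hom[OF R.cring_axioms UP_cring const_ring_hom assms(2)] by simp
  ultimately show ?thesis
    using P.foldr_linear_eq_sum[of "lin_factor R x" "monom P (\<one> \<oplus> x) 0" "map (\<lambda>b. monom P b 0) bs"]
      root_coeffs_circle_eq_foldr[OF assms] assms
    by (simp add: lin_factor_closed del: monom_add)
qed

text \<open>Allows one family of roots of a polynomial to be exchanged for another, one block of
  \<open>root_coeffs_circle\<close> at a time.\<close>

lemma root_coeffs_circle_roots_cong:
  assumes "set as \<subseteq> carrier R" "set bs \<subseteq> carrier R" "set bs' \<subseteq> carrier R"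
    and "length bs = length bs'" "root_coeffs R bs = root_coeffs R bs'"
  shows "root_coeffs R (circle_roots R as bs) = root_coeffs R (circle_roots R as bs')"
  using assms(1)
proof (induction as)
  case Nil
  then show ?case by (simp add: circle_roots_def)
next
  case (Cons a as)
  have a: "a \<in> carrier R" and as: "set as \<subseteq> carrier R" using Cons.prems by auto
  have circle: "set (map (\<lambda>y. a \<oplus> y \<oplus> a \<otimes> y) cs) \<subseteq> carrier R" if "set cs \<subseteq> carrier R" for cs
    using that a by auto
  show ?case
    using Cons.IH[OF as] root_coeffs_circle[OF a assms(2)] root_coeffs_circle[OF a assms(3)] assms
      root_coeffs_append[OF circle[OF assms(2)] R.circle_roots_closed[OF as assms(2)]]
      root_coeffs_append[OF circle[OF assms(3)] R.circle_roots_closed[OF as assms(3)]]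
    by (simp add: circle_roots_def)
qed

text \<open>The roots \<open>as\<close> lie in \<open>X\<close> themselves, while the
  \<open>bs\<close> enter through their coefficients alone, so every block is a polynomial over
  \<open>X\<close>.\<close>

lemma root_coeffs_circle_roots_polys_over:
  assumes X: "subring X R" and "set as \<subseteq> X" "set bs \<subseteq> carrier R" "\<And>k. root_coeffs R bs k \<in> X"
  shows "root_coeffs R (circle_roots R as bs) \<in> polys_over R X"
  using assms(2)
proof (induction as)
  note K = subringE[OF polys_over_subring[OF X]]
  case Nil
  then show ?case using K by (simp add: circle_roots_def root_coeffs_Nil del: root_coeffs.simps)
next
  interpret P: cring P by (rule UP_cring)
  note XR = subringE[OF X]
  note K = subringE[OF polys_over_subring[OF X]]
  case (Cons a as)
  have a: "a \<in> X" "a \<in> carrier R" and as: "set as \<subseteq> X" "set as \<subseteq> carrier R"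
    using Cons.prems XR(1) by auto
  have circle: "set (map (\<lambda>y. a \<oplus> y \<oplus> a \<otimes> y) bs) \<subseteq> carrier R" using assms(3) a by auto
  have const: "monom P c 0 \<in> polys_over R X" if "c \<in> X" for c
    using that XR(1,2) by (auto simp: polys_over_def P_def[symmetric] monom_nth)
  have lin: "lin_factor R a \<in> polys_over R X"
    using a XR(2,3,5) lin_factor_closed[OF a(2)]
    by (auto simp: polys_over_def P_def[symmetric] lin_factor_nth)
  have "root_coeffs R (map (\<lambda>y. a \<oplus> y \<oplus> a \<otimes> y) bs) \<in> polys_over R X"
    unfolding root_coeffs_circle[OF a(2) assms(3)]
    by (intro P.subring_finsum_closed[OF polys_over_subring[OF X]] K(6) const lin assms(4)
        P.subring_nat_pow_closed[OF polys_over_subring[OF X]] XR(7) XR(3) a(1))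
  then show ?case
    using K(6) Cons.IH[OF as(1)]
      root_coeffs_append[OF circle R.circle_roots_closed[OF as(2) assms(3)]]
    by (simp add: circle_roots_def)
qed

text \<open>Splits the first column off a grid of roots that is listed row by row.\<close>

lemma root_coeffs_concat_Cons:
  assumes "\<And>b. b \<in> set bs \<Longrightarrow> f b \<in> carrier R \<and> set (g b) \<subseteq> carrier R"
  shows "root_coeffs R (concat (map (\<lambda>b. f b # g b) bs)) =
    root_coeffs R (map f bs) \<otimes>\<^bsub>P\<^esub> root_coeffs R (concat (map g bs))"
  using assms
proof (induction bs)
  case Nil
  then show ?case by (simp add: root_coeffs_Nil del: root_coeffs.simps)
next
  interpret P: cring P by (rule UP_cring)
  case (Cons b bs)
  have c: "set (map f bs) \<subseteq> carrier R" "set (concat (map g bs)) \<subseteq> carrier R"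
    "set (concat (map (\<lambda>b. f b # g b) bs)) \<subseteq> carrier R" "f b \<in> carrier R" "set (g b) \<subseteq> carrier R"
    using Cons.prems by (auto dest: subsetD)
  then show ?case
    using Cons
    by (simp add: root_coeffs_Cons root_coeffs_append root_coeffs_in_carrier lin_factor_closed P.m_ac
        del: root_coeffs.simps set_concat set_map)
qed

text \<open>The same grid is read by rows and by columns; the order of factors is immaterial in the
  polynomial.\<close>

lemma root_coeffs_circle_roots_commute:
  assumes "set as \<subseteq> carrier R" "set bs \<subseteq> carrier R"
  shows "root_coeffs R (circle_roots R as bs) = root_coeffs R (circle_roots R bs as)"
  using assms(1)
proof (induction as)
  case Nil
  have "concat (map (\<lambda>x. []) bs) = ([] :: 'a list)" by (induction bs) auto
  then show ?case by (simp only: circle_roots_def list.map concat.simps)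
next
  case (Cons a as)
  have a: "a \<in> carrier R" and as: "set as \<subseteq> carrier R" using Cons.prems by auto
  have circle: "set (map (\<lambda>y. a \<oplus> y \<oplus> a \<otimes> y) bs) \<subseteq> carrier R" using assms(2) a by auto
  have "circle_roots R bs (a # as) =
      concat (map (\<lambda>b. (b \<oplus> a \<oplus> b \<otimes> a) # map (\<lambda>y. b \<oplus> y \<oplus> b \<otimes> y) as) bs)"
    by (simp add: circle_roots_def)
  moreover have "root_coeffs R \<dots> =
      root_coeffs R (map (\<lambda>b. b \<oplus> a \<oplus> b \<otimes> a) bs) \<otimes>\<^bsub>P\<^esub> root_coeffs R (circle_roots R bs as)"
    unfolding circle_roots_def using assms(2) a as by (intro root_coeffs_concat_Cons) auto
  moreover have "map (\<lambda>b. b \<oplus> a \<oplus> b \<otimes> a) bs = map (\<lambda>b. a \<oplus> b \<oplus> a \<otimes> b) bs"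
    using assms(2) a by (auto simp: R.a_comm R.m_comm)
  ultimately show ?case
    using Cons.IH[OF as] root_coeffs_append[OF circle R.circle_roots_closed[OF as assms(2)]]
    by (simp add: circle_roots_def)
qed

text \<open>The polynomial is computed twice: from roots \<open>as\<close> in \<open>X\<close> with
  the \<open>bs\<close> entering symmetrically, and from roots \<open>bs'\<close> in
  \<open>Y\<close> with the \<open>as\<close> entering symmetrically.\<close>

lemma root_coeffs_circle_roots_Int:
  assumes "subring X R" "subring Y R"
    and "set as \<subseteq> X" "set bs \<subseteq> carrier R" "set bs' \<subseteq> Y" "length bs = length bs'"
    and "root_coeffs R bs = root_coeffs R bs'"
    and "\<And>k. root_coeffs R as k \<in> Y" "\<And>k. root_coeffs R bs k \<in> X"
  shows "root_coeffs R (circle_roots R as bs) k \<in> X \<inter> Y"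
proof -
  have as: "set as \<subseteq> carrier R" and bs': "set bs' \<subseteq> carrier R"
    using assms subringE(1)[OF assms(1)] subringE(1)[OF assms(2)] by auto
  have "root_coeffs R (circle_roots R as bs) = root_coeffs R (circle_roots R bs' as)"
    using root_coeffs_circle_roots_cong[OF as assms(4) bs' assms(6,7)]
      root_coeffs_circle_roots_commute[OF as bs'] by simp
  then show ?thesis
    using root_coeffs_circle_roots_polys_over[OF assms(1,3,4,9)]
      root_coeffs_circle_roots_polys_over[OF assms(2,5) as assms(8)]
    by (simp add: polys_over_def)
qed

end

section \<open>Adjoining generic roots of a monic polynomial\<close>

lemma ring_hom_image_subring:
  assumes "ring R" "ring S" "\<phi> \<in> ring_hom R S" "subring X R"
  shows "subring (\<phi> ` X) S"
  using ring_hom_ring.img_is_subring[OF ring_hom_ringI2[OF assms(1-3)] assms(4)] .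

context UP_cring
begin

text \<open>
  The extension is a copy of \<open>R[t]/(p)\<close> on the prescribed type \<open>'d\<close>, obtained by choosing a
  representative of each coset and encoding it by \<open>enc\<close>. This allows the construction to be
  iterated in the induction of \<open>ex_splitting_extension\<close>, which works on the single type
  \<open>nat \<Rightarrow> 'a\<close>.
\<close>

lemma ex_root_extension:
  fixes enc :: "(nat \<Rightarrow> 'a) \<Rightarrow> 'd"
  assumes "inj enc" and p: "monic_of_degree R N p" and "N > 0"
  shows "\<exists>(C :: 'd ring) \<psi> \<beta>. cring C \<and> \<psi> \<in> ring_hom R C \<and> inj_on \<psi> (carrier R) \<and> \<beta> \<in> carrier C \<and>
    (\<Oplus>\<^bsub>C\<^esub>k\<in>{..N}. \<psi> (p k) \<otimes>\<^bsub>C\<^esub> \<beta> [^]\<^bsub>C\<^esub> k) = \<zero>\<^bsub>C\<^esub> \<and>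
    (\<forall>A. subring A R \<longrightarrow> p \<in> polys_over R A \<longrightarrow>
       (\<exists>Y. subring Y C \<and> \<psi> ` A \<subseteq> Y \<and> \<beta> \<in> Y \<and> Y \<inter> \<psi> ` carrier R \<subseteq> \<psi> ` A))"
proof -
  interpret P: cring P by (rule UP_cring)
  have pP: "p \<in> carrier P" and pN: "p N = \<one>" and p0: "\<And>k. N < k \<Longrightarrow> p k = \<zero>"
    using p by (auto simp: monic_of_degree_def P_def)
  define I where "I = PIdl\<^bsub>P\<^esub> p"
  have I_eq: "I = {x \<otimes>\<^bsub>P\<^esub> p | x. x \<in> carrier P}" by (simp only: I_def cgenideal_def)
  have idealI: "ideal I P" unfolding I_def using pP by (rule P.cgenideal_ideal)
  note add_I = additive_subgroup.a_closed[OF ideal.axioms(1)[OF idealI]]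
  note zero_I = additive_subgroup.zero_closed[OF ideal.axioms(1)[OF idealI]]
  note neg_I = additive_subgroup.a_inv_closed[OF ideal.axioms(1)[OF idealI]]
  \<comment> \<open>In other words, a coset of \<open>I\<close> has at most one representative of
    degree below \<open>N\<close>.\<close>
  have I_zero: "f = \<zero>\<^bsub>P\<^esub>" if "f \<in> I" "\<And>k. N \<le> k \<Longrightarrow> f k = \<zero>" for f
  proof -
    have "\<exists>q. f = q \<otimes>\<^bsub>P\<^esub> p \<and> q \<in> carrier P"
      using that(1) by (simp only: I_eq mem_Collect_eq)
    then obtain q where q: "q \<in> carrier P" "f = q \<otimes>\<^bsub>P\<^esub> p"
      by (elim exE conjE)
    then have "f = p \<otimes>\<^bsub>P\<^esub> q" using P.m_comm[OF q(1) pP] by simp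
    then have "q = \<zero>\<^bsub>P\<^esub>" using monic_mult_eq_zero[OF pP pN p0 q(1)] that(2) by simp
    then show ?thesis using q pP by simp
  qed
  have pI: "p \<otimes>\<^bsub>P\<^esub> q \<in> I" if "q \<in> carrier P" for q
    using P.m_comm[OF pP that] that by (auto simp only: I_eq mem_Collect_eq)
  define f where "f = (\<lambda>g. enc (SOME h. h \<in> carrier P \<and> h \<ominus>\<^bsub>P\<^esub> g \<in> I))"
  \<comment> \<open>Once \<open>f\<close> identifies exactly the polynomials congruent modulo
    \<open>I\<close>, the ring structure carries over to its image.\<close>
  have weak: "weak_ring_morphism f I P"
  proof (rule weak_ring_morphismI[OF idealI])
    fix a b assume ab: "a \<in> carrier P" "b \<in> carrier P"
    have tr: "h \<ominus>\<^bsub>P\<^esub> c \<in> I" if "h \<in> carrier P" "a \<in> carrier P" "c \<in> carrier P"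
      "h \<ominus>\<^bsub>P\<^esub> a \<in> I" "a \<ominus>\<^bsub>P\<^esub> c \<in> I" for h a c
    proof -
      have "(h \<ominus>\<^bsub>P\<^esub> a) \<oplus>\<^bsub>P\<^esub> (a \<ominus>\<^bsub>P\<^esub> c) = h \<ominus>\<^bsub>P\<^esub> c"
        using that by (simp add: P.minus_eq P.a_assoc P.r_neg1)
      then show ?thesis using add_I that by metis
    qed
    have sym: "b \<ominus>\<^bsub>P\<^esub> a \<in> I" if "a \<in> carrier P" "b \<in> carrier P" "a \<ominus>\<^bsub>P\<^esub> b \<in> I" for a b
    proof -
      have "\<ominus>\<^bsub>P\<^esub> (a \<ominus>\<^bsub>P\<^esub> b) = b \<ominus>\<^bsub>P\<^esub> a"
        using that by (simp add: P.minus_eq P.minus_add P.a_comm)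
      then show ?thesis using neg_I that by metis
    qed
    show "f a = f b \<longleftrightarrow> a \<ominus>\<^bsub>P\<^esub> b \<in> I"
    proof
      assume "a \<ominus>\<^bsub>P\<^esub> b \<in> I"
      \<comment> \<open>Congruent polynomials give \<open>SOME\<close> the same predicate, hence the
        same representative.\<close>
      then have "h \<in> carrier P \<and> h \<ominus>\<^bsub>P\<^esub> a \<in> I \<longleftrightarrow> h \<in> carrier P \<and> h \<ominus>\<^bsub>P\<^esub> b \<in> I" for h
        using tr ab sym by blast
      then show "f a = f b" by (simp add: f_def)
    next
      assume eq: "f a = f b"
      define h where "h = (\<lambda>c. SOME h. h \<in> carrier P \<and> h \<ominus>\<^bsub>P\<^esub> c \<in> I)"
      have ex: "h c \<in> carrier P \<and> h c \<ominus>\<^bsub>P\<^esub> c \<in> I" if "c \<in> carrier P" for c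
        unfolding h_def by (rule someI[of _ c]) (use that zero_I in \<open>simp add: P.minus_eq P.r_neg\<close>)
      have "h a = h b" using eq injD[OF assms(1)] by (simp add: f_def h_def)
      then have h: "h a \<in> carrier P" "h a \<ominus>\<^bsub>P\<^esub> a \<in> I" "h a \<ominus>\<^bsub>P\<^esub> b \<in> I"
        using ex[OF ab(1)] ex[OF ab(2)] by simp_all
      show "a \<ominus>\<^bsub>P\<^esub> b \<in> I"
        using tr[OF ab(1) h(1) ab(2) sym[OF h(1) ab(1) h(2)] h(3)] .
    qed
  qed
  define C where "C = image_ring f P"
  have f_hom: "f \<in> ring_hom P C" unfolding C_def by (rule P.weak_ring_morphism_is_hom[OF weak])
  have ringC: "ring C" unfolding C_def by (rule P.image_ring_is_ring[OF weak])
  have carC: "carrier C = f ` carrier P" by (simp add: C_def image_ring_carrier)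
  have cringC: "cring C"
  proof (rule cring.intro[OF ringC], unfold_locales)
  qed (use ringC carC in \<open>auto simp: ring.ring_simprules ring_hom_mult[OF f_hom, symmetric] P.m_assoc P.m_comm
      ring_hom_one[OF f_hom, symmetric]\<close>)
  interpret f: ring_hom_cring P C f
    using f_hom cringC P.cring_axioms by (simp add: ring_hom_cring_def ring_hom_cring_axioms_def)
  define \<psi> where "\<psi> = (\<lambda>s. f (monom P s 0))"
  define \<beta> where "\<beta> = f (monom P \<one> 1)"
  have psi_hom: "\<psi> \<in> ring_hom R C"
    using ring_hom_trans[OF const_ring_hom f_hom] by (simp add: \<psi>_def comp_def)
  have f_eq: "f a = f b \<longleftrightarrow> a \<ominus>\<^bsub>P\<^esub> b \<in> I" if "a \<in> carrier P" "b \<in> carrier P" for a b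
    using weak that by (simp add: weak_ring_morphism_def weak_ring_morphism_axioms_def)
  \<comment> \<open>Here \<open>N > 0\<close> matters: a constant has no coefficient from
    \<open>N\<close> on, so \<open>r\<close> minus the constant is a multiple of \<open>p\<close> of
    degree below \<open>N\<close>.\<close>
  have f_inj: "r = monom P s 0"
    if "f r = \<psi> s" "s \<in> carrier R" "r \<in> carrier P" "\<And>k. N \<le> k \<Longrightarrow> r k = \<zero>" for r s
  proof -
    have "r \<ominus>\<^bsub>P\<^esub> monom P s 0 \<in> I" using that f_eq by (simp add: \<psi>_def)
    moreover have "(r \<ominus>\<^bsub>P\<^esub> monom P s 0) k = \<zero>" if "N \<le> k" for k
      using that \<open>\<And>k. N \<le> k \<Longrightarrow> r k = \<zero>\<close> \<open>s \<in> carrier R\<close> \<open>r \<in> carrier P\<close> assms(3)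
      by (simp add: minus_nth monom_nth R.minus_eq)
    ultimately have "r \<ominus>\<^bsub>P\<^esub> monom P s 0 = \<zero>\<^bsub>P\<^esub>" by (rule I_zero)
    then show ?thesis using that by simp
  qed
  have inj: "inj_on \<psi> (carrier R)"
  proof (rule inj_onI)
    fix s t assume st: "s \<in> carrier R" "t \<in> carrier R" "\<psi> s = \<psi> t"
    have "monom P s 0 = monom P t 0"
    proof (rule f_inj)
      show "f (monom P s 0) = \<psi> t" using st(3) unfolding \<psi>_def .
      show "monom P s 0 k = \<zero>" if "N \<le> k" for k
        using monom_nth[OF st(1), of 0 k] that assms(3) by simp
    qed (use st(1,2) in simp_all)
    then have "monom P s 0 0 = monom P t 0 0" by (rule fun_cong)
    then show "s = t" unfolding monom_nth[OF st(1)] monom_nth[OF st(2)] by simp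
  qed
  \<comment> \<open>\<open>\<beta>\<close> is the class of \<open>t\<close>, so this sum is the
    class of \<open>p\<close> itself.\<close>
  have root: "(\<Oplus>\<^bsub>C\<^esub>k\<in>{..N}. \<psi> (p k) \<otimes>\<^bsub>C\<^esub> \<beta> [^]\<^bsub>C\<^esub> k) = \<zero>\<^bsub>C\<^esub>"
  proof -
    have pow: "monom P \<one> 1 [^]\<^bsub>P\<^esub> k = monom P \<one> k" for k :: nat
    proof (induction k)
      case (Suc k)
      then show ?case using monom_one_Suc[of k] by simp
    qed simp
    have cf: "p k \<in> carrier R" for k using carrier_nth[OF pP] .
    have mm: "monom P (p k) 0 \<otimes>\<^bsub>P\<^esub> monom P \<one> k = monom P (p k) k" for k
      using monom_mult[of "p k" \<one> 0 k, symmetric] cf by (simp del: monom_mult)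
    have "deg R p \<le> N" using p0 pP by (intro deg_aboveI) (auto simp: coeff_eq)
    then have "p = (\<Oplus>\<^bsub>P\<^esub>k\<in>{..N}. monom P (p k) k)"
      using up_repr_le[of p N] pP by (simp add: coeff_eq)
    also have "\<dots> = (\<Oplus>\<^bsub>P\<^esub>k\<in>{..N}. monom P (p k) 0 \<otimes>\<^bsub>P\<^esub> monom P \<one> 1 [^]\<^bsub>P\<^esub> k)"
      using cf by (intro P.finsum_cong') (auto simp only: pow mm Pi_iff monom_closed)
    finally have "f p = f (\<Oplus>\<^bsub>P\<^esub>k\<in>{..N}. monom P (p k) 0 \<otimes>\<^bsub>P\<^esub> monom P \<one> 1 [^]\<^bsub>P\<^esub> k)"
      by simp
    also have "\<dots> = (\<Oplus>\<^bsub>C\<^esub>k\<in>{..N}. f (monom P (p k) 0 \<otimes>\<^bsub>P\<^esub> monom P \<one> 1 [^]\<^bsub>P\<^esub> k))"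
      using cf by (subst f.hom_finsum) (auto simp: comp_def)
    also have "\<dots> = (\<Oplus>\<^bsub>C\<^esub>k\<in>{..N}. \<psi> (p k) \<otimes>\<^bsub>C\<^esub> \<beta> [^]\<^bsub>C\<^esub> k)"
      using cf by (intro f.S.finsum_cong') (auto simp: \<psi>_def \<beta>_def f.hom_pow[symmetric] simp del: f.hom_pow)
    finally have "f p = (\<Oplus>\<^bsub>C\<^esub>k\<in>{..N}. \<psi> (p k) \<otimes>\<^bsub>C\<^esub> \<beta> [^]\<^bsub>C\<^esub> k)" .
    moreover have "f p = f \<zero>\<^bsub>P\<^esub>"
      using pI[of "\<one>\<^bsub>P\<^esub>"] pP f_eq[of p "\<zero>\<^bsub>P\<^esub>"] by (simp add: P.minus_eq del: f.hom_zero)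
    ultimately show ?thesis by simp
  qed
  have sub: "\<exists>Y. subring Y C \<and> \<psi> ` A \<subseteq> Y \<and> \<beta> \<in> Y \<and> Y \<inter> \<psi> ` carrier R \<subseteq> \<psi> ` A"
    if A: "subring A R" and pA: "p \<in> polys_over R A" for A
  proof (intro exI conjI)
    note K = subringE[OF polys_over_subring[OF A]]
    note Ar = subringE[OF A]
    have mon: "monom P a j \<in> polys_over R A" if "a \<in> A" for a j
      using that Ar(1,2) by (auto simp: polys_over_def P_def[symmetric] monom_nth)
    \<comment> \<open>The witness is the image of \<open>A[t]\<close>, that is, \<open>A\<close>
      with \<open>\<beta>\<close> adjoined.\<close>
    show "subring (f ` polys_over R A) C"
      using ring_hom_image_subring[OF P.ring_axioms ringC f_hom polys_over_subring[OF A]] .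
    show "\<psi> ` A \<subseteq> f ` polys_over R A" using mon by (auto simp: \<psi>_def)
    show "\<beta> \<in> f ` polys_over R A" using mon Ar(3) by (auto simp: \<beta>_def)
    show "f ` polys_over R A \<inter> \<psi> ` carrier R \<subseteq> \<psi> ` A"
    proof
      fix y assume "y \<in> f ` polys_over R A \<inter> \<psi> ` carrier R"
      then obtain g s where g: "g \<in> polys_over R A" "y = f g" and s: "s \<in> carrier R" "y = \<psi> s"
        by blast
      \<comment> \<open>The remainder of \<open>g\<close> is computed over \<open>A\<close>. It is
        congruent to the constant \<open>s\<close> and has degree below \<open>N\<close>, hence it
        equals that constant, and \<open>s\<close> lies in \<open>A\<close>.\<close>
      obtain q r where qr: "q \<in> polys_over R A" "r \<in> polys_over R A"
        "g = p \<otimes>\<^bsub>P\<^esub> q \<oplus>\<^bsub>P\<^esub> r" "\<forall>k\<ge>N. r k = \<zero>"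
        using division_by_monic[OF A pA pN p0 g(1)] by blast
      have qP: "q \<in> carrier P" "r \<in> carrier P" using qr K(1) by auto
      have "g \<ominus>\<^bsub>P\<^esub> r = p \<otimes>\<^bsub>P\<^esub> q"
        using qP pP by (simp add: qr(3) P.minus_eq P.a_assoc P.r_neg)
      then have "f g = f r" using f_eq[of g r] pI[OF qP(1)] qP pP qr(3) by simp
      then have "r = monom P s 0" using f_inj[of r s] g s qP qr by simp
      then have "s = r 0" using s by (simp add: monom_nth)
      then show "y \<in> \<psi> ` A" using qr(2) s(2) by (auto simp: polys_over_def)
    qed
  qed
  have "\<beta> \<in> carrier C" by (simp add: \<beta>_def)
  then show ?thesis using cringC psi_hom inj root sub by blast
qed

text \<open>The factor theorem, with the remainder identified as the value of \<open>f\<close> at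
  \<open>\<beta>\<close>. As the quotient is again monic over \<open>X\<close>, the next root can be
  adjoined with \<open>X\<close> as the base.\<close>

lemma linear_division:
  assumes X: "subring X R" and \<beta>: "\<beta> \<in> X" and f: "f \<in> polys_over R X" "monic_of_degree R (Suc N) f"
    and root: "(\<Oplus>k\<in>{..Suc N}. f k \<otimes> \<beta> [^] k) = \<zero>"
  shows "\<exists>q\<in>polys_over R X. monic_of_degree R N q \<and> f = lin_factor R \<beta> \<otimes>\<^bsub>P\<^esub> q"
proof -
  interpret P: cring P by (rule UP_cring)
  note XR = subringE[OF X]
  note K = subringE[OF polys_over_subring[OF X]]
  have b: "\<beta> \<in> carrier R" using \<beta> XR by auto
  have lin: "lin_factor R \<beta> \<in> polys_over R X"
    using \<beta> XR(2,3,5) lin_factor_closed[OF b]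
    by (auto simp: polys_over_def P_def[symmetric] lin_factor_nth b)
  obtain q r where qr: "q \<in> polys_over R X" "r \<in> polys_over R X"
    "f = lin_factor R \<beta> \<otimes>\<^bsub>P\<^esub> q \<oplus>\<^bsub>P\<^esub> r" "\<forall>k\<ge>1. r k = \<zero>"
    using division_by_monic[OF X lin, of 1 f] f(1) b by (auto simp: lin_factor_nth)
  have qP: "q \<in> carrier P" "r \<in> carrier P" using qr K(1) by auto
  note [simp] = carrier_nth[OF qP(1)] carrier_nth[OF qP(2)] b
  have f0: "f 0 = r 0 \<ominus> \<beta> \<otimes> q 0"
    using qP by (simp add: qr(3) add_nth lin_factor_closed lin_factor_mult_nth R.minus_eq R.a_comm)
  have fS: "f (Suc k) = q k \<ominus> \<beta> \<otimes> q (Suc k)" for k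
    using qP qr(4) by (simp add: qr(3) add_nth lin_factor_closed lin_factor_mult_nth R.minus_eq)
  \<comment> \<open>Horner's rule: the partial sums telescope, so the remainder is the value at \<open>\<beta>\<close>.\<close>
  have tel: "(\<Oplus>k\<in>{..n}. f k \<otimes> \<beta> [^] k) = r 0 \<ominus> \<beta> [^] Suc n \<otimes> q n" for n
  proof (induction n)
    case 0
    then show ?case by (simp add: f0)
  next
    case (Suc n)
    have "f k \<in> carrier R" for k by (cases k) (auto simp: f0 fS)
    then have "(\<Oplus>k\<in>{..Suc n}. f k \<otimes> \<beta> [^] k) =
        (q n \<ominus> \<beta> \<otimes> q (Suc n)) \<otimes> \<beta> [^] Suc n \<oplus> (r 0 \<ominus> \<beta> [^] Suc n \<otimes> q n)"
      using Suc by (subst R.finsum_Suc) (auto simp: fS simp del: R.nat_pow_Suc)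
    also have "\<dots> = r 0 \<ominus> \<beta> [^] Suc (Suc n) \<otimes> q (Suc n)"
    proof -
      have g: "(a \<ominus> \<beta> \<otimes> c) \<otimes> m \<oplus> (d \<ominus> m \<otimes> a) = d \<ominus> (m \<otimes> \<beta>) \<otimes> c"
        if "a \<in> carrier R" "c \<in> carrier R" "d \<in> carrier R" "m \<in> carrier R" for a c d m
        using that b by algebra
      show ?thesis using g[of "q n" "q (Suc n)" "r 0" "\<beta> [^] Suc n"] by simp
    qed
    finally show ?case .
  qed
  obtain n where n: "\<forall>k\<ge>n. q k = \<zero>" using carrier_bound[OF qP(1)] by blast
  have f_high: "f k = \<zero>" if "Suc N < k" for k using f(2) that by (simp add: monic_of_degree_def)
  \<comment> \<open>Above \<open>N\<close> one has \<open>q k = \<beta> q (k + 1)\<close>, so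
    vanishing descends from the bound \<open>n\<close>; \<open>d\<close> counts the steps of the
    descent.\<close>
  have "\<forall>k>N. k + d \<ge> n \<longrightarrow> q k = \<zero>" for d
  proof (induction d)
    case 0
    then show ?case using n by simp
  next
    case (Suc d)
    show ?case
    proof (intro allI impI)
      fix k assume k: "N < k" "n \<le> k + Suc d"
      then have "q (Suc k) = \<zero>" using Suc by simp
      then show "q k = \<zero>" using fS[of k] f_high[of "Suc k"] k by (simp add: R.minus_eq)
    qed
  qed
  from this[of n] have q_high: "q k = \<zero>" if "N < k" for k using that by simp
  have "q N = \<one>"
    using fS[of N] q_high[of "Suc N"] f(2) by (simp add: R.minus_eq monic_of_degree_def)
  then have monic: "monic_of_degree R N q"
    using qP q_high by (simp add: monic_of_degree_def P_def)
  have "r = \<zero>\<^bsub>P\<^esub>"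
  proof (rule carrier_eqI[OF qP(2)])
    fix k
    \<comment> \<open>At \<open>Suc N\<close> the partial sum is the value of \<open>f\<close> at
      \<open>\<beta>\<close>, and \<open>q (Suc N)\<close> is 0, so \<open>tel\<close> leaves only
      \<open>r 0\<close>.\<close>
    have "r 0 = \<zero>" using tel[of "Suc N"] root q_high[of "Suc N"] by (simp add: R.minus_eq)
    then show "r k = \<zero>\<^bsub>P\<^esub> k" using qr(4) by (cases k) (auto simp: zero_nth)
  qed simp
  then have "f = lin_factor R \<beta> \<otimes>\<^bsub>P\<^esub> q"
    using qr(3) qP lin_factor_closed[OF b] by simp
  then show ?thesis using qr(1) monic by blast
qed

end


text \<open>Polynomials over a ring on \<open>nat \<Rightarrow> 'a\<close> are doubly indexed.
  Flattening them by the pairing function returns the quotient ring to the type of the original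
  ring.\<close>

definition encode_seqs :: "(nat \<Rightarrow> nat \<Rightarrow> 'a) \<Rightarrow> nat \<Rightarrow> 'a" where
  "encode_seqs g n = (case prod_decode n of (i, j) \<Rightarrow> g i j)"

lemma inj_encode_seqs: "inj encode_seqs"
proof (rule injI)
  fix g h :: "nat \<Rightarrow> nat \<Rightarrow> 'a"
  assume eq: "encode_seqs g = encode_seqs h"
  have "g i j = h i j" for i j
    using fun_cong[OF eq, of "prod_encode (i, j)"]
    by (simp add: encode_seqs_def)
  then show "g = h" by blast
qed

lemma polys_over_hom:
  assumes "\<phi> \<in> ring_hom R S" "cring R" "cring S" "p \<in> polys_over R A" "\<phi> ` A \<subseteq> B"
  shows "(\<lambda>k. \<phi> (p k)) \<in> polys_over S B"
proof -
  interpret R: UP_cring R "UP R" using assms(2) by (simp add: UP_cring_def)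
  interpret S: UP_cring S "UP S" using assms(3) by (simp add: UP_cring_def)
  have p: "p \<in> carrier (UP R)" "\<And>k. p k \<in> A" using assms(4) by (auto simp: polys_over_def)
  obtain n where n: "\<forall>k\<ge>n. p k = \<zero>\<^bsub>R\<^esub>" using R.carrier_bound p by blast
  have "\<phi> \<zero>\<^bsub>R\<^esub> = \<zero>\<^bsub>S\<^esub>" using ring_hom_zero[OF assms(1) cring.axioms(1)[OF assms(2)] cring.axioms(1)[OF assms(3)]] .
  then have "(\<lambda>k. \<phi> (p k)) \<in> carrier (UP S)"
    using n R.carrier_nth[OF p(1)] ring_hom_closed[OF assms(1)]
    by (intro S.carrierI[where N = n]) auto
  then show ?thesis using p(2) assms(5) by (auto simp: polys_over_def)
qed

lemma monic_of_degree_hom: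
  assumes "\<phi> \<in> ring_hom R S" "cring R" "cring S" "monic_of_degree R N p"
  shows "monic_of_degree S N (\<lambda>k. \<phi> (p k))"
proof -
  have p: "p \<in> carrier (UP R)" using assms(4) by (simp add: monic_of_degree_def)
  have "(\<lambda>k. \<phi> (p k)) \<in> polys_over S UNIV"
    using p by (intro polys_over_hom[OF assms(1-3), of _ UNIV]) (auto simp: polys_over_def)
  moreover have "\<phi> \<zero>\<^bsub>R\<^esub> = \<zero>\<^bsub>S\<^esub>" using ring_hom_zero[OF assms(1) cring.axioms(1)[OF assms(2)] cring.axioms(1)[OF assms(3)]] .
  ultimately show ?thesis
    using assms(4) ring_hom_one[OF assms(1)] by (auto simp: monic_of_degree_def polys_over_def)
qed

text \<open>Adjoins a root, divides by its linear factor and continues with the quotient.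
  \<open>Y\<close> is a subring containing \<open>A\<close> and all new roots that meets the old
  ring only in \<open>A\<close>; in the induction the \<open>Y1\<close> of the first root takes the
  place of \<open>A\<close>.\<close>

lemma ex_splitting_extension:
  fixes S :: "(nat \<Rightarrow> 'a) ring"
  assumes "cring S" "monic_of_degree S N p" "subring A S" "p \<in> polys_over S A"
  shows "\<exists>(C :: (nat \<Rightarrow> 'a) ring) \<psi> bs Y. cring C \<and> \<psi> \<in> ring_hom S C \<and> inj_on \<psi> (carrier S) \<and>
    length bs = N \<and> root_coeffs C bs = (\<lambda>k. \<psi> (p k)) \<and>
    subring Y C \<and> \<psi> ` A \<subseteq> Y \<and> set bs \<subseteq> Y \<and> Y \<inter> \<psi> ` carrier S \<subseteq> \<psi> ` A"
  using assms
proof (induction N arbitrary: S p A)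
  case 0
  \<comment> \<open>A monic polynomial of degree 0 is 1, so \<open>S\<close> itself serves, with
    \<open>Y = A\<close>.\<close>
  then have "root_coeffs S [] = (\<lambda>k. p k)" by (auto simp: monic_of_degree_def)
  moreover have "(\<lambda>x. x) \<in> ring_hom S S" by (auto intro!: ring_hom_memI)
  ultimately show ?case
    using 0 by (intro exI[of _ S] exI[of _ "\<lambda>x. x"] exI[of _ "[]"] exI[of _ A]) simp
next
  case (Suc N)
  interpret S: UP_cring S "UP S" using Suc.prems by (simp add: UP_cring_def)
  obtain C1 :: "(nat \<Rightarrow> 'a) ring" and \<psi>1 \<beta> where C1: "cring C1" "\<psi>1 \<in> ring_hom S C1"
      "inj_on \<psi>1 (carrier S)" "\<beta> \<in> carrier C1"
      "(\<Oplus>\<^bsub>C1\<^esub>k\<in>{..Suc N}. \<psi>1 (p k) \<otimes>\<^bsub>C1\<^esub> \<beta> [^]\<^bsub>C1\<^esub> k) = \<zero>\<^bsub>C1\<^esub>"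
    and ext: "\<forall>A. subring A S \<longrightarrow> p \<in> polys_over S A \<longrightarrow>
       (\<exists>Y. subring Y C1 \<and> \<psi>1 ` A \<subseteq> Y \<and> \<beta> \<in> Y \<and> Y \<inter> \<psi>1 ` carrier S \<subseteq> \<psi>1 ` A)"
  proof -
    from S.ex_root_extension[OF inj_encode_seqs Suc.prems(2) zero_less_Suc] show thesis
      by (elim exE conjE) (rule that)
  qed
  obtain Y1 where Y1: "subring Y1 C1" "\<psi>1 ` A \<subseteq> Y1" "\<beta> \<in> Y1"
      "Y1 \<inter> \<psi>1 ` carrier S \<subseteq> \<psi>1 ` A"
    using ext[rule_format, OF Suc.prems(3,4)] by (elim exE conjE) simp
  interpret C1: UP_cring C1 "UP C1" using C1 by (simp add: UP_cring_def)
  obtain q where q: "q \<in> polys_over C1 Y1" "monic_of_degree C1 N q"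
      "(\<lambda>k. \<psi>1 (p k)) = lin_factor C1 \<beta> \<otimes>\<^bsub>UP C1\<^esub> q"
    using C1.linear_division[OF Y1(1,3) polys_over_hom[OF C1(2) Suc.prems(1) C1(1) Suc.prems(4) Y1(2)]
        monic_of_degree_hom[OF C1(2) Suc.prems(1) C1(1) Suc.prems(2)] C1(5)] by blast
  obtain C :: "(nat \<Rightarrow> 'a) ring" and \<psi>2 bs Y where C: "cring C" "\<psi>2 \<in> ring_hom C1 C"
      "inj_on \<psi>2 (carrier C1)" "length bs = N" "root_coeffs C bs = (\<lambda>k. \<psi>2 (q k))"
      "subring Y C" "\<psi>2 ` Y1 \<subseteq> Y" "set bs \<subseteq> Y" "Y \<inter> \<psi>2 ` carrier C1 \<subseteq> \<psi>2 ` Y1"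
  proof -
    from Suc.IH[OF C1(1) q(2) Y1(1) q(1)] show thesis by (elim exE conjE) (rule that)
  qed
  have sub: "\<psi>1 ` carrier S \<subseteq> carrier C1" "Y1 \<subseteq> carrier C1"
    using ring_hom_closed[OF C1(2)] subringE(1)[OF Y1(1)] by auto
  have qP: "q \<in> carrier (UP C1)" using q(1) by (simp add: polys_over_def)
  interpret h: ring_hom_cring C1 C \<psi>2
    using C C1 by (simp add: ring_hom_cring_def ring_hom_cring_axioms_def)
  have coeffs: "root_coeffs C (\<psi>2 \<beta> # bs) k = (\<psi>2 \<circ> \<psi>1) (p k)" for k
  proof -
    have "\<psi>1 (p k) = (case k of 0 \<Rightarrow> \<zero>\<^bsub>C1\<^esub> | Suc j \<Rightarrow> q j) \<ominus>\<^bsub>C1\<^esub> \<beta> \<otimes>\<^bsub>C1\<^esub> q k"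
      using fun_cong[OF q(3), of k] C1.lin_factor_mult_nth[OF C1(4) qP] by simp
    then show ?thesis
      using C1.carrier_nth[OF qP] C1(4)
      by (simp add: C(5) a_minus_def split: nat.split)
  qed
  show ?case
  proof (intro exI conjI)
    show "cring C" "subring Y C" using C by auto
    show "\<psi>2 \<circ> \<psi>1 \<in> ring_hom S C" using ring_hom_trans[OF C1(2) C(2)] .
    show "inj_on (\<psi>2 \<circ> \<psi>1) (carrier S)"
      using comp_inj_on[OF C1(3) inj_on_subset[OF C(3) sub(1)]] .
    show "length (\<psi>2 \<beta> # bs) = Suc N" using C by simp
    show "root_coeffs C (\<psi>2 \<beta> # bs) = (\<lambda>k. (\<psi>2 \<circ> \<psi>1) (p k))" using coeffs by blast
    show "(\<psi>2 \<circ> \<psi>1) ` A \<subseteq> Y" using Y1(2) C(7) by auto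
    show "set (\<psi>2 \<beta> # bs) \<subseteq> Y" using Y1(3) C(7,8) by auto
    show "Y \<inter> (\<psi>2 \<circ> \<psi>1) ` carrier S \<subseteq> (\<psi>2 \<circ> \<psi>1) ` A"
    proof
      fix y assume "y \<in> Y \<inter> (\<psi>2 \<circ> \<psi>1) ` carrier S"
      then obtain s where s: "y \<in> Y" "s \<in> carrier S" "y = \<psi>2 (\<psi>1 s)" by auto
      \<comment> \<open>The two intersection clauses are chained: \<open>y\<close> comes from
        \<open>Y1\<close>, by injectivity of \<open>\<psi>2\<close> from \<open>\<psi>1 s\<close>,
        and the clause for \<open>Y1\<close> then leads into \<open>A\<close>.\<close>
      then obtain y1 where y1: "y1 \<in> Y1" "y = \<psi>2 y1" using C(9) sub by blast
      then have "y1 = \<psi>1 s" using inj_onD[OF C(3)] s sub by blast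
      then show "y \<in> (\<psi>2 \<circ> \<psi>1) ` A" using y1 s Y1(4) by auto
    qed
  qed
qed

section \<open>Characteristic polynomials and the algebra of linear recurrent sequences\<close>

context cring
begin

text \<open>Index \<open>i\<close> of the recurrence is exponent \<open>k = N - i\<close>, so
  \<open>{1..N}\<close> matches the exponents below \<open>N\<close>; the leading 1 contributes
  \<open>a (m + N)\<close>.\<close>

lemma monic_sum_eq:
  assumes "\<And>i. i \<in> {1..N} \<Longrightarrow> h i \<in> carrier R" "a \<in> seqs R" "p N = \<one>"
    and "\<And>k. k < N \<Longrightarrow> p k = \<ominus> h (N - k)"
  shows "(\<Oplus>k\<in>{..N}. p k \<otimes> a (m + k)) = a (m + N) \<ominus> (\<Oplus>i\<in>{1..N}. h i \<otimes> a (m + N - i))"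
proof -
  note [simp] = assms(1) seqsD[OF assms(2)]
  have p: "p k \<in> carrier R" if "k < N" for k using assms(1)[of "N - k"] assms(4) that by simp
  have inj: "inj_on (\<lambda>i. N - i) {1..N}" by (auto simp: inj_on_def)
  have img: "(\<lambda>i. N - i) ` {1..N} = {..<N}"
  proof (intro equalityI subsetI)
    fix x assume "x \<in> {..<N}"
    then have "x = N - (N - x)" "N - x \<in> {1..N}" by auto
    then show "x \<in> (\<lambda>i. N - i) ` {1..N}" by blast
  qed auto
  have "(\<Oplus>k\<in>{..N}. p k \<otimes> a (m + k)) = a (m + N) \<oplus> (\<Oplus>k\<in>{..<N}. p k \<otimes> a (m + k))"
    unfolding lessThan_Suc_atMost[symmetric] lessThan_Suc
    using p by (subst finsum_insert) (auto simp: assms(3))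
  also have "(\<Oplus>k\<in>{..<N}. p k \<otimes> a (m + k)) = (\<Oplus>i\<in>{1..N}. p (N - i) \<otimes> a (m + (N - i)))"
    using finsum_reindex[OF _ inj, of "\<lambda>k. p k \<otimes> a (m + k)", unfolded img] p
    by (simp add: Pi_iff)
  also have "\<dots> = (\<Oplus>i\<in>{1..N}. (\<ominus> \<one>) \<otimes> (h i \<otimes> a (m + N - i)))"
    using assms(4) by (intro finsum_cong') (auto simp: l_minus)
  also have "\<dots> = (\<ominus> \<one>) \<otimes> (\<Oplus>i\<in>{1..N}. h i \<otimes> a (m + N - i))"
    by (subst finsum_rdistr) auto
  finally show ?thesis by (simp add: l_minus minus_eq finsum_closed Pi_iff)
qed

text \<open>Trades the existential \<open>h\<close> for the coefficients of \<open>p\<close>: the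
  recurrence at \<open>n = m + N\<close> says that \<open>p\<close>, with \<open>t\<close> acting as
  the shift, kills \<open>a\<close>.\<close>

lemma has_charpoly_iff:
  assumes "a \<in> seqs R"
  shows "has_charpoly R N p a \<longleftrightarrow>
    monic_of_degree R N p \<and> (\<forall>m. (\<Oplus>k\<in>{..N}. p k \<otimes> a (m + k)) = \<zero>)"
proof -
  interpret U: UP_cring R "UP R" using cring_axioms by (simp add: UP_cring_def)
  note [simp] = seqsD[OF assms]
  define P where "P = UP R"
  interpret P: cring P unfolding P_def by (rule U.UP_cring)
  let ?F = "\<lambda>h. monom P \<one> N \<ominus>\<^bsub>P\<^esub> (\<Oplus>\<^bsub>P\<^esub>i\<in>{1..N}. monom P (h i) (N - i))"
  have F: "?F h \<in> carrier P" "?F h k = (if k = N then \<one> else if k < N then \<ominus> h (N - k) else \<zero>)"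
    if h: "h \<in> {1..N} \<rightarrow> carrier R" for h k
  proof -
    have mon: "(\<lambda>i. monom P (h i) (N - i)) \<in> {1..N} \<rightarrow> carrier P"
      using h by (auto simp: P_def Pi_iff)
    then have sP: "(\<Oplus>\<^bsub>P\<^esub>i\<in>{1..N}. monom P (h i) (N - i)) \<in> carrier P" by simp
    have "(\<Oplus>\<^bsub>P\<^esub>i\<in>{1..N}. monom P (h i) (N - i)) k = (\<Oplus>i\<in>{1..N}. monom P (h i) (N - i) k)"
    proof -
      have "(\<Oplus>\<^bsub>P\<^esub>i\<in>{1..N}. monom P (h i) (N - i)) k =
          (\<Oplus>i\<in>{1..N}. coeff P (monom P (h i) (N - i)) k)"
        using U.coeff_finsum[of "{1..N}" "\<lambda>i. monom P (h i) (N - i)" k] mon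
          U.coeff_eq[OF sP[unfolded P_def], of k]
        by (simp add: P_def)
      also have "\<dots> = (\<Oplus>i\<in>{1..N}. monom P (h i) (N - i) k)"
        using mon U.coeff_eq U.carrier_nth by (intro finsum_cong') (auto simp: P_def Pi_iff)
      finally show ?thesis .
    qed
    also have "\<dots> = (\<Oplus>i\<in>{1..N}. if N - k = i \<and> k < N then h i else \<zero>)"
      using h by (intro finsum_cong') (auto simp: P_def U.monom_nth Pi_iff)
    also have "\<dots> = (if k < N then h (N - k) else \<zero>)"
    proof (cases "k < N")
      case True
      then have "N - k \<in> {1..N}" by auto
      then show ?thesis
        using finsum_singleton[of "N - k" "{1..N}" h] h True by simp
    qed (auto intro!: add.finprod_one_eqI)
    finally show "?F h k = (if k = N then \<one> else if k < N then \<ominus> h (N - k) else \<zero>)"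
      using sP h by (auto simp: P_def U.minus_nth U.monom_nth minus_eq Pi_iff)
    show "?F h \<in> carrier P" using sP by (simp add: P_def[symmetric]) (simp add: P_def)
  qed
  show ?thesis
  proof
    assume "has_charpoly R N p a"
    then obtain h where h: "h \<in> {1..N} \<rightarrow> carrier R" "p = ?F h"
      "\<And>n. n \<ge> N \<Longrightarrow> a n = (\<Oplus>i\<in>{1..N}. h i \<otimes> a (n - i))"
      unfolding has_charpoly_def P_def by blast
    have "monic_of_degree R N p"
      unfolding monic_of_degree_def P_def[symmetric] using F[OF h(1)] h(2) by auto
    moreover have "(\<Oplus>k\<in>{..N}. p k \<otimes> a (m + k)) = \<zero>" for m
    proof -
      have "(\<Oplus>k\<in>{..N}. p k \<otimes> a (m + k)) = a (m + N) \<ominus> (\<Oplus>i\<in>{1..N}. h i \<otimes> a (m + N - i))"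
        using h F[OF h(1)] assms by (intro monic_sum_eq) auto
      also have "\<dots> = \<zero>" using h(3)[of "m + N", symmetric] by (simp add: minus_eq r_neg)
      finally show ?thesis .
    qed
    ultimately show "monic_of_degree R N p \<and> (\<forall>m. (\<Oplus>k\<in>{..N}. p k \<otimes> a (m + k)) = \<zero>)" by blast
  next
    assume *: "monic_of_degree R N p \<and> (\<forall>m. (\<Oplus>k\<in>{..N}. p k \<otimes> a (m + k)) = \<zero>)"
    define h where "h i = \<ominus> p (N - i)" for i
    have p: "p \<in> carrier P" "p N = \<one>" "\<And>k. N < k \<Longrightarrow> p k = \<zero>"
      using * by (auto simp: monic_of_degree_def P_def)
    have pc: "p k \<in> carrier R" for k using U.carrier_nth p(1) by (simp add: P_def)
    have h: "h \<in> {1..N} \<rightarrow> carrier R" using pc by (auto simp: h_def)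
    have "p k = ?F h k" for k
      unfolding F(2)[OF h] using p pc by (auto simp: h_def)
    then have "p = ?F h" by blast
    moreover have "a n = (\<Oplus>i\<in>{1..N}. h i \<otimes> a (n - i))" if "n \<ge> N" for n
    proof -
      have "(\<Oplus>k\<in>{..N}. p k \<otimes> a (n - N + k)) =
          a (n - N + N) \<ominus> (\<Oplus>i\<in>{1..N}. h i \<otimes> a (n - N + N - i))"
        using pc h assms p by (intro monic_sum_eq) (auto simp: h_def)
      moreover have "(\<Oplus>k\<in>{..N}. p k \<otimes> a (n - N + k)) = \<zero>" using * by blast
      ultimately have "a n \<ominus> (\<Oplus>i\<in>{1..N}. h i \<otimes> a (n - i)) = \<zero>"
        using that by (simp only: le_add_diff_inverse2)
      moreover have "(\<Oplus>i\<in>{1..N}. h i \<otimes> a (n - i)) \<in> carrier R"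
        using h by (intro finsum_closed) auto
      ultimately show ?thesis by simp
    qed
    ultimately show "has_charpoly R N p a"
      unfolding has_charpoly_def P_def[symmetric] using h by blast
  qed
qed

end

section \<open>Transfer of recurrences along an embedding of rings, and descent\<close>

locale cring_embedding = ring_hom_cring R S \<phi> for R (structure) and S (structure) and \<phi> +
  assumes inj: "inj_on \<phi> (carrier R)"
begin

lemma seqs_hom: "a \<in> seqs R \<Longrightarrow> (\<lambda>n. \<phi> (a n)) \<in> seqs S"
  by (simp add: seqs_def)

lemma hom_add_pow: "x \<in> carrier R \<Longrightarrow> \<phi> (add_pow R (n::nat) x) = add_pow S n (\<phi> x)"
  by (induction n) (simp_all)

lemma newton_prod_hom:
  assumes "a \<in> seqs R" "b \<in> seqs R"
  shows "newton_prod S (\<lambda>n. \<phi> (a n)) (\<lambda>n. \<phi> (b n)) = (\<lambda>n. \<phi> (newton_prod R a b n))"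
proof
  fix n
  note [simp] = seqsD[OF assms(1)] seqsD[OF assms(2)]
  have "\<phi> (newton_prod R a b n) = (\<Oplus>\<^bsub>S\<^esub>i\<in>{0..n}. \<phi> (\<Oplus>j\<in>{0..i}.
        add_pow R ((n choose i) * (i choose j)) (a i \<otimes> b (n - j))))"
    unfolding newton_prod_def by (subst hom_finsum) (auto simp: comp_def intro!: R.finsum_closed)
  also have "\<dots> = newton_prod S (\<lambda>n. \<phi> (a n)) (\<lambda>n. \<phi> (b n)) n"
    unfolding newton_prod_def
  proof (rule S.finsum_cong')
    fix i assume "i \<in> {0..n}"
    show "\<phi> (\<Oplus>j\<in>{0..i}. add_pow R ((n choose i) * (i choose j)) (a i \<otimes> b (n - j))) =
      (\<Oplus>\<^bsub>S\<^esub>j\<in>{0..i}. add_pow S ((n choose i) * (i choose j)) (\<phi> (a i) \<otimes>\<^bsub>S\<^esub> \<phi> (b (n - j))))"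
      by (subst hom_finsum) (auto simp: hom_add_pow intro!: S.finsum_cong')
  qed (auto intro!: S.finsum_closed)
  finally show "newton_prod S (\<lambda>n. \<phi> (a n)) (\<lambda>n. \<phi> (b n)) n = \<phi> (newton_prod R a b n)" by simp
qed

text \<open>By \<open>fold_lin_op_eq_sum\<close>, annihilation over \<open>S\<close> is the image of
  a family of linear relations over \<open>R\<close>, and an injective \<open>\<phi>\<close> detects
  zero.\<close>

lemma annihilated_hom_iff:
  assumes "a \<in> seqs R" "set xs \<subseteq> carrier S" "p \<in> carrier (UP R)"
    and "root_coeffs S xs = (\<lambda>k. \<phi> (p k))"
  shows "(\<lambda>n. \<phi> (a n)) \<in> annihilated S xs \<longleftrightarrow>
    (\<forall>m. (\<Oplus>k\<in>{..length xs}. p k \<otimes> a (m + k)) = \<zero>)"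
proof -
  interpret UP_cring R "UP R" using R.cring_axioms by (simp add: UP_cring_def)
  have [simp]: "p k \<in> carrier R" "a k \<in> carrier R" for k
    using carrier_nth[OF assms(3)] seqsD[OF assms(1)] by auto
  have closed: "(\<Oplus>k\<in>{..length xs}. p k \<otimes> a (m + k)) \<in> carrier R" for m
    by (simp add: R.finsum_closed Pi_iff)
  have "fold (lin_op S) xs (\<lambda>n. \<phi> (a n)) m = \<phi> (\<Oplus>k\<in>{..length xs}. p k \<otimes> a (m + k))" for m
    using S.fold_lin_op_eq_sum[OF assms(2) seqs_hom[OF assms(1)]] assms(4)
    by (subst hom_finsum) (auto intro!: S.finsum_cong')
  moreover have "\<phi> (\<Oplus>k\<in>{..length xs}. p k \<otimes> a (m + k)) = \<zero>\<^bsub>S\<^esub> \<longleftrightarrow>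
      (\<Oplus>k\<in>{..length xs}. p k \<otimes> a (m + k)) = \<zero>" for m
    using inj_onD[OF inj _ closed[of m], of \<zero>] hom_zero by (metis R.zero_closed)
  ultimately show ?thesis
    by (simp add: annihilated_def seqs_hom assms(1) fun_eq_iff del: hom_finsum)
qed

lemma has_charpoly_hom_iff:
  assumes "a \<in> seqs R" "set xs \<subseteq> carrier S" "monic_of_degree R (length xs) p"
    and "root_coeffs S xs = (\<lambda>k. \<phi> (p k))"
  shows "has_charpoly R (length xs) p a \<longleftrightarrow> (\<lambda>n. \<phi> (a n)) \<in> annihilated S xs"
  using annihilated_hom_iff[OF assms(1,2) _ assms(4)] assms(3) R.has_charpoly_iff[OF assms(1)]
  by (simp add: monic_of_degree_def)

text \<open>The coefficients are pulled back through the injective \<open>\<phi>\<close>; the result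
  is monic of the same degree because 1 and 0 have only one preimage each.\<close>

lemma has_charpoly_descend:
  assumes "c \<in> seqs R" "set xs \<subseteq> carrier S" "(\<lambda>n. \<phi> (c n)) \<in> annihilated S xs"
    and "\<And>k. root_coeffs S xs k \<in> \<phi> ` carrier R"
  shows "\<exists>q\<in>carrier (UP R). has_charpoly R (length xs) q c \<and> root_coeffs S xs = (\<lambda>k. \<phi> (q k))"
proof -
  interpret UP_cring R "UP R" using R.cring_axioms by (simp add: UP_cring_def)
  define q where "q k = inv_into (carrier R) \<phi> (root_coeffs S xs k)" for k
  have q: "q k \<in> carrier R" "\<phi> (q k) = root_coeffs S xs k" for k
    using inv_into_into[OF assms(4)] f_inv_into_f[OF assms(4)] by (auto simp: q_def)
  have "q (length xs) = \<one>"
    using inj_onD[OF inj, of "q (length xs)" \<one>] q S.root_coeffs_lead[OF assms(2)] by simp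
  moreover have q0: "q k = \<zero>" if "length xs < k" for k
    using inj_onD[OF inj, of "q k" \<zero>] q S.root_coeffs_above[OF assms(2) that] by simp
  moreover have "q \<in> carrier (UP R)" using q q0 by (intro carrierI[where N = "length xs"]) auto
  ultimately have monic: "monic_of_degree R (length xs) q" by (simp add: monic_of_degree_def)
  have rc: "root_coeffs S xs = (\<lambda>k. \<phi> (q k))" using q by auto
  show ?thesis
    using has_charpoly_hom_iff[OF assms(1,2) monic rc] assms(3) rc \<open>q \<in> carrier (UP R)\<close> by blast
qed

end

section \<open>Existence of rings in which given monic polynomials split\<close>

lemma cring_embeddingI:
  "cring R \<Longrightarrow> cring S \<Longrightarrow> \<phi> \<in> ring_hom R S \<Longrightarrow> inj_on \<phi> (carrier R) \<Longrightarrow> cring_embedding R S \<phi>"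
  by (simp add: cring_embedding_def cring_embedding_axioms_def ring_hom_cring_def ring_hom_cring_axioms_def)

lemma cring_embedding_comp:
  assumes "cring_embedding R S \<phi>" "cring_embedding S T \<psi>"
  shows "cring_embedding R T (\<psi> \<circ> \<phi>)"
proof -
  interpret f: cring_embedding R S \<phi> by fact
  interpret g: cring_embedding S T \<psi> by fact
  have "inj_on (\<psi> \<circ> \<phi>) (carrier R)"
    using f.inj inj_on_subset[OF g.inj, of "\<phi> ` carrier R"] by (intro comp_inj_on) auto
  then show ?thesis
    using ring_hom_trans[OF f.homh g.homh] f.R.cring_axioms g.S.cring_axioms
    by (intro cring_embeddingI)
qed

text \<open>A copy of \<open>R\<close> by constant sequences, placed on the type on which
  \<open>ex_splitting_extension\<close> works.\<close>

lemma (in cring) ex_const_embedding: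
  "\<exists>S :: (nat \<Rightarrow> 'a) ring. cring_embedding R S (\<lambda>x n. x)"
proof -
  let ?f = "\<lambda>x (n::nat). x :: 'a"
  have inj: "inj_on ?f (carrier R)" by (auto simp: inj_on_def fun_eq_iff)
  have iso: "?f \<in> ring_iso R (image_ring ?f R)" using inj_imp_image_ring_iso[OF inj] .
  \<comment> \<open>The updated zero is the one that \<open>image_ring\<close> already has, so the
    update disappears on unfolding.\<close>
  have "cring (image_ring ?f R\<lparr>zero := ?f \<zero>\<rparr>)" by (rule ring_iso_imp_img_cring[OF iso])
  then have "cring (image_ring ?f R)" by (simp add: image_ring_def image_group_def monoid.defs)
  then show ?thesis
    using cring_embeddingI[OF cring_axioms _ _ inj] iso by (auto simp: ring_iso_def)
qed

text \<open>Splits \<open>p\<close> first and then \<open>q\<close> over the resulting ring,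
  carrying the roots of \<open>p\<close> along.\<close>

lemma (in cring) ex_splitting_embedding:
  assumes "monic_of_degree R M p" "monic_of_degree R N q"
  shows "\<exists>(S :: (nat \<Rightarrow> 'a) ring) \<phi> as bs. cring_embedding R S \<phi> \<and>
    set as \<subseteq> carrier S \<and> set bs \<subseteq> carrier S \<and> length as = M \<and> length bs = N \<and>
    root_coeffs S as = (\<lambda>k. \<phi> (p k)) \<and> root_coeffs S bs = (\<lambda>k. \<phi> (q k))"
proof -
  have split: "\<exists>(C :: (nat \<Rightarrow> 'a) ring) \<psi> bs. cring_embedding S C \<psi> \<and> set bs \<subseteq> carrier C \<and>
      length bs = n \<and> root_coeffs C bs = (\<lambda>k. \<psi> (f k))"
    if S: "cring S" "monic_of_degree S n f" for S :: "(nat \<Rightarrow> 'a) ring" and n f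
  proof -
    interpret S: UP_cring S "UP S" using S by (simp add: UP_cring_def)
    \<comment> \<open>With the whole carrier as \<open>A\<close>, only the splitting part of the
      extension is used.\<close>
    have "f \<in> polys_over S (carrier S)"
      using S(2) S.carrier_nth by (auto simp: polys_over_def monic_of_degree_def)
    from ex_splitting_extension[OF S S.R.carrier_is_subring this]
    show ?thesis
    proof (elim exE conjE)
      fix C :: "(nat \<Rightarrow> 'a) ring" and \<psi> bs Y
      assume C: "cring C" "\<psi> \<in> ring_hom S C" "inj_on \<psi> (carrier S)" "length bs = n"
        "root_coeffs C bs = (\<lambda>k. \<psi> (f k))" "subring Y C" "set bs \<subseteq> Y"
      have "set bs \<subseteq> carrier C" using C(7) subringE(1)[OF C(6)] by simp
      then show ?thesis
        using C cring_embeddingI[OF S(1) C(1-3)]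
        by (intro exI[of _ C] exI[of _ \<psi>] exI[of _ bs]) simp
    qed
  qed
  obtain S0 :: "(nat \<Rightarrow> 'a) ring" where S0: "cring_embedding R S0 (\<lambda>x n. x)"
    using ex_const_embedding by blast
  define \<iota> where "\<iota> = (\<lambda>(x::'a) (n::nat). x)"
  interpret i: cring_embedding R S0 \<iota> unfolding \<iota>_def by (rule S0)
  obtain S1 :: "(nat \<Rightarrow> 'a) ring" and \<psi>1 as where S1: "cring_embedding S0 S1 \<psi>1" "set as \<subseteq> carrier S1"
      "length as = M" "root_coeffs S1 as = (\<lambda>k. \<psi>1 (\<iota> (p k)))"
    using split[OF i.S.cring_axioms monic_of_degree_hom[OF i.homh cring_axioms i.S.cring_axioms assms(1)]]
    by blast
  interpret e1: cring_embedding R S1 "\<psi>1 \<circ> \<iota>"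
    using cring_embedding_comp[OF i.cring_embedding_axioms S1(1)] .
  obtain S2 :: "(nat \<Rightarrow> 'a) ring" and \<psi>2 bs where S2: "cring_embedding S1 S2 \<psi>2" "set bs \<subseteq> carrier S2"
      "length bs = N" "root_coeffs S2 bs = (\<lambda>k. \<psi>2 ((\<psi>1 \<circ> \<iota>) (q k)))"
    using split[OF e1.S.cring_axioms monic_of_degree_hom[OF e1.homh cring_axioms e1.S.cring_axioms assms(2)]]
    by blast
  interpret f2: cring_embedding S1 S2 \<psi>2 by (rule S2(1))
  have "root_coeffs S2 (map \<psi>2 as) = (\<lambda>k. (\<psi>2 \<circ> (\<psi>1 \<circ> \<iota>)) (p k))"
    using root_coeffs_hom[OF e1.S.cring_axioms f2.S.cring_axioms f2.homh S1(2)] S1(4)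
    by (simp add: fun_eq_iff)
  moreover have "set (map \<psi>2 as) \<subseteq> carrier S2" using S1(2) by auto
  ultimately show ?thesis
    using S1 S2 cring_embedding_comp[OF e1.cring_embedding_axioms S2(1)]
    by (intro exI[of _ S2] exI[of _ "\<psi>2 \<circ> (\<psi>1 \<circ> \<iota>)"] exI[of _ "map \<psi>2 as"] exI[of _ bs]) simp
qed

text \<open>In the larger ring \<open>C\<close>, \<open>X\<close> is the image of \<open>S\<close>
  and \<open>Y\<close> contains the image of \<open>R\<close> together with the generic roots
  \<open>bs'\<close>. The coefficients lie in both, and the common part is the image of
  \<open>R\<close>.\<close>

lemma (in cring_embedding) circle_roots_coeffs_in_image:
  assumes "set as \<subseteq> carrier S" "set bs \<subseteq> carrier S"
    and p: "root_coeffs S as = (\<lambda>k. \<phi> (p k))" "p \<in> carrier (UP R)"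
    and q: "root_coeffs S bs = (\<lambda>k. \<phi> (q k))" "monic_of_degree R (length bs) q"
  shows "root_coeffs S (circle_roots S as bs) k \<in> \<phi> ` carrier R"
proof -
  interpret RP: UP_cring R "UP R" using R.cring_axioms by (simp add: UP_cring_def)
  obtain S0 :: "(nat \<Rightarrow> 'c) ring" where S0: "cring_embedding S S0 (\<lambda>x n. x)"
    using S.ex_const_embedding by blast
  define \<iota> where "\<iota> = (\<lambda>(x::'c) (n::nat). x)"
  interpret i: cring_embedding S S0 \<iota> unfolding \<iota>_def by (rule S0)
  interpret e: cring_embedding R S0 "\<iota> \<circ> \<phi>"
    using cring_embedding_comp[OF cring_embedding_axioms i.cring_embedding_axioms] .
  define A where "A = (\<iota> \<circ> \<phi>) ` carrier R"
  have A: "subring A S0"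
    unfolding A_def
    using ring_hom_image_subring[OF R.ring_axioms i.S.ring_axioms e.homh R.carrier_is_subring] .
  have qm: "monic_of_degree S0 (length bs) (\<lambda>k. (\<iota> \<circ> \<phi>) (q k))"
    using monic_of_degree_hom[OF e.homh R.cring_axioms i.S.cring_axioms q(2)] .
  have qA: "(\<lambda>k. (\<iota> \<circ> \<phi>) (q k)) \<in> polys_over S0 A"
    using polys_over_hom[OF e.homh R.cring_axioms i.S.cring_axioms, of q "carrier R" A] q(2)
      RP.carrier_nth
    by (auto simp: polys_over_def monic_of_degree_def A_def)
  obtain C :: "(nat \<Rightarrow> 'c) ring" and \<psi> bs' Y where C: "cring C" "\<psi> \<in> ring_hom S0 C"
      "inj_on \<psi> (carrier S0)" "length bs' = length bs"
      "root_coeffs C bs' = (\<lambda>k. \<psi> ((\<iota> \<circ> \<phi>) (q k)))" "subring Y C" "\<psi> ` A \<subseteq> Y" "set bs' \<subseteq> Y"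
      "Y \<inter> \<psi> ` carrier S0 \<subseteq> \<psi> ` A"
  proof -
    from ex_splitting_extension[OF i.S.cring_axioms qm A qA] show thesis
      by (elim exE conjE) (rule that)
  qed
  interpret c: cring_embedding S C "\<psi> \<circ> \<iota>"
    using cring_embedding_comp[OF i.cring_embedding_axioms cring_embeddingI[OF i.S.cring_axioms C(1-3)]] .
  interpret CP: UP_cring C "UP C" using C(1) by (simp add: UP_cring_def)
  let ?\<kappa> = "\<psi> \<circ> \<iota>"
  define X where "X = ?\<kappa> ` carrier S"
  have X: "subring X C"
    unfolding X_def
    using ring_hom_image_subring[OF S.ring_axioms c.S.ring_axioms c.homh S.carrier_is_subring] .
  have rc: "root_coeffs C (map ?\<kappa> xs) = (\<lambda>k. ?\<kappa> (root_coeffs S xs k))" if "set xs \<subseteq> carrier S" for xs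
    using root_coeffs_hom[OF S.cring_axioms C(1) c.homh that] by (simp add: fun_eq_iff)
  have pc: "p k \<in> carrier R" for k using RP.carrier_nth[OF p(2)] .
  have "root_coeffs C (circle_roots C (map ?\<kappa> as) (map ?\<kappa> bs)) k \<in> X \<inter> Y"
  proof (rule CP.root_coeffs_circle_roots_Int[OF X C(6) _ _ C(8)])
    show "set (map ?\<kappa> as) \<subseteq> X" using assms(1) by (auto simp: X_def)
    show "set (map ?\<kappa> bs) \<subseteq> carrier C" unfolding set_map using assms(2) c.hom_closed by blast
    show "length (map ?\<kappa> bs) = length bs'" using C(4) by simp
    show "root_coeffs C (map ?\<kappa> bs) = root_coeffs C bs'"
      unfolding rc[OF assms(2)] C(5) q(1) by simp
    show "root_coeffs C (map ?\<kappa> as) k \<in> Y" for k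
      unfolding rc[OF assms(1)] p(1) using C(7) pc by (auto simp: A_def)
    show "root_coeffs C (map ?\<kappa> bs) k \<in> X" for k
      unfolding rc[OF assms(2)] X_def using S.root_coeffs_closed[OF assms(2)] by blast
  qed
  moreover have "root_coeffs C (circle_roots C (map ?\<kappa> as) (map ?\<kappa> bs)) k =
      ?\<kappa> (root_coeffs S (circle_roots S as bs) k)"
    using rc[OF S.circle_roots_closed[OF assms(1,2)]]
      circle_roots_hom[OF c.homh S.cring_axioms assms(1,2)] by simp
  moreover have cl: "root_coeffs S (circle_roots S as bs) k \<in> carrier S"
    by (rule S.root_coeffs_closed[OF S.circle_roots_closed[OF assms(1,2)]])
  ultimately have "?\<kappa> (root_coeffs S (circle_roots S as bs) k) \<in> Y \<inter> \<psi> ` carrier S0"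
    by auto
  then obtain r where r: "r \<in> carrier R"
      "?\<kappa> (root_coeffs S (circle_roots S as bs) k) = ?\<kappa> (\<phi> r)"
    using C(9) by (auto simp: A_def)
  then have "root_coeffs S (circle_roots S as bs) k = \<phi> r"
    using inj_onD[OF c.inj] cl by auto
  then show ?thesis using r(1) by blast
qed

section \<open>Characteristic polynomials of Newton products and of sums\<close>

lemma length_circle_roots: "length (circle_roots R xs ys) = length xs * length ys"
  by (induction xs) (simp_all add: circle_roots_def)

lemma (in cring_embedding) has_charpoly_newton_prod:
  assumes "a \<in> seqs R" "b \<in> seqs R" "set as \<subseteq> carrier S" "set bs \<subseteq> carrier S"
    and p: "root_coeffs S as = (\<lambda>k. \<phi> (p k))" "has_charpoly R (length as) p a"
    and q: "root_coeffs S bs = (\<lambda>k. \<phi> (q k))" "has_charpoly R (length bs) q b"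
  shows "\<exists>r\<in>carrier (UP R). has_charpoly R (length as * length bs) r (newton_prod R a b) \<and>
    root_coeffs S (circle_roots S as bs) = (\<lambda>k. \<phi> (r k))"
proof -
  have m: "monic_of_degree R (length as) p" "monic_of_degree R (length bs) q"
    using p(2) q(2) R.has_charpoly_iff assms(1,2) by auto
  have "(\<lambda>n. \<phi> (newton_prod R a b n)) \<in> annihilated S (circle_roots S as bs)"
    unfolding newton_prod_hom[OF assms(1,2), symmetric] circle_roots_def
    using S.annihilated_newton_prod[OF assms(3,4)]
      has_charpoly_hom_iff[OF assms(1,3) m(1) p(1)] has_charpoly_hom_iff[OF assms(2,4) m(2) q(1)] p q
    by blast
  moreover have "root_coeffs S (circle_roots S as bs) k \<in> \<phi> ` carrier R" for k
    using circle_roots_coeffs_in_image[OF assms(3,4) p(1) _ q(1) m(2)] m(1)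
    by (simp add: monic_of_degree_def)
  ultimately show ?thesis
    using has_charpoly_descend[OF R.newton_prod_closed[OF assms(1,2)] S.circle_roots_closed[OF assms(3,4)]]
    by (simp add: length_circle_roots)
qed

text \<open>The product of the two polynomials annihilates both sequences. Its coefficients lie in
  the image of \<open>R\<close> because that image is a subring.\<close>

lemma (in cring_embedding) has_charpoly_add:
  assumes "a \<in> seqs R" "b \<in> seqs R" "set as \<subseteq> carrier S" "set bs \<subseteq> carrier S"
    and p: "root_coeffs S as = (\<lambda>k. \<phi> (p k))" "has_charpoly R (length as) p a"
    and q: "root_coeffs S bs = (\<lambda>k. \<phi> (q k))" "has_charpoly R (length bs) q b"
  shows "\<exists>r. has_charpoly R (length as + length bs) r (\<lambda>n. a n \<oplus> b n)"
proof -
  interpret SP: UP_cring S "UP S" using S.cring_axioms by (simp add: UP_cring_def)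
  have m: "monic_of_degree R (length as) p" "monic_of_degree R (length bs) q"
    using p(2) q(2) R.has_charpoly_iff assms(1,2) by auto
  let ?a = "\<lambda>n. \<phi> (a n)" and ?b = "\<lambda>n. \<phi> (b n)"
  have ann: "?a \<in> annihilated S as" "?b \<in> annihilated S bs"
    using has_charpoly_hom_iff[OF assms(1,3) m(1) p(1)] has_charpoly_hom_iff[OF assms(2,4) m(2) q(1)] p q
    by auto
  have "?a \<in> annihilated S (as @ bs)"
    using S.annihilated_append[OF assms(3) seqs_hom[OF assms(1)]] ann(1) S.annihilated_zero[OF assms(4)]
    by (simp add: annihilated_def)
  \<comment> \<open>The operators of \<open>as\<close> act first; since all operators commute, they
    leave \<open>?b\<close> annihilated by \<open>bs\<close>.\<close>
  moreover have "?b \<in> annihilated S (as @ bs)"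
    using S.annihilated_append[OF assms(3) seqs_hom[OF assms(2)]]
      S.annihilated_fold[OF assms(4,3) ann(2)] by simp
  ultimately have "(\<lambda>n. ?a n \<oplus>\<^bsub>S\<^esub> ?b n) \<in> annihilated S (as @ bs)"
    using assms(3,4) by (intro S.annihilated_add) auto
  then have 1: "(\<lambda>n. \<phi> (a n \<oplus> b n)) \<in> annihilated S (as @ bs)"
    using seqsD[OF assms(1)] seqsD[OF assms(2)] by simp
  have im: "subring (\<phi> ` carrier R) S"
    using ring_hom_image_subring[OF R.ring_axioms S.ring_axioms homh R.carrier_is_subring] .
  have over: "(\<lambda>k. \<phi> (f k)) \<in> polys_over S (\<phi> ` carrier R)" if "f \<in> carrier (UP R)" for f
  proof -
    interpret RP: UP_cring R "UP R" using R.cring_axioms by (simp add: UP_cring_def)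
    show ?thesis
      using that RP.carrier_nth[OF that]
      by (intro polys_over_hom[OF homh R.cring_axioms S.cring_axioms, of _ "carrier R"])
        (auto simp: polys_over_def)
  qed
  have "root_coeffs S (as @ bs) \<in> polys_over S (\<phi> ` carrier R)"
    unfolding SP.root_coeffs_append[OF assms(3,4)] p(1) q(1)
    using subringE(6)[OF SP.polys_over_subring[OF im] over over] m
    by (simp add: monic_of_degree_def)
  then have 2: "root_coeffs S (as @ bs) k \<in> \<phi> ` carrier R" for k by (simp add: polys_over_def)
  have 3: "set (as @ bs) \<subseteq> carrier S" using assms(3,4) by simp
  show ?thesis
    using has_charpoly_descend[OF R.seqs_add[OF assms(1,2)] 3 1 2] by auto
qed

section \<open>Closure of the linear recurrent sequences and the algebra axioms\<close>

context cring
begin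

lemma linrec_seqsE:
  assumes "a \<in> linrec_seqs R"
  obtains N p where "a \<in> seqs R" "has_charpoly R N p a" "monic_of_degree R N p"
  using assms has_charpoly_iff unfolding linrec_seqs_def by blast

text \<open>No splitting ring is given here, so one is constructed; the resulting recurrence has
  coefficients in \<open>R\<close>.\<close>

lemma linrec_newton_prod_add_closed:
  assumes "a \<in> linrec_seqs R" "b \<in> linrec_seqs R"
  shows "newton_prod R a b \<in> linrec_seqs R" "(\<lambda>n. a n \<oplus> b n) \<in> linrec_seqs R"
proof -
  obtain M p where a: "a \<in> seqs R" "has_charpoly R M p a" "monic_of_degree R M p"
    using assms(1) by (rule linrec_seqsE)
  obtain N q where b: "b \<in> seqs R" "has_charpoly R N q b" "monic_of_degree R N q"
    using assms(2) by (rule linrec_seqsE)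
  obtain S :: "(nat \<Rightarrow> 'a) ring" and \<phi> as bs where S: "cring_embedding R S \<phi>"
    "set as \<subseteq> carrier S" "set bs \<subseteq> carrier S" "length as = M" "length bs = N"
    "root_coeffs S as = (\<lambda>k. \<phi> (p k))" "root_coeffs S bs = (\<lambda>k. \<phi> (q k))"
  proof -
    from ex_splitting_embedding[OF a(3) b(3)] show thesis by (elim exE conjE) (rule that)
  qed
  interpret E: cring_embedding R S \<phi> by (rule S(1))
  show "newton_prod R a b \<in> linrec_seqs R"
    using E.has_charpoly_newton_prod[OF a(1) b(1) S(2,3,6) _ S(7)] a b S(4,5)
      newton_prod_closed[OF a(1) b(1)]
    by (auto simp: linrec_seqs_def)
  show "(\<lambda>n. a n \<oplus> b n) \<in> linrec_seqs R"
    using E.has_charpoly_add[OF a(1) b(1) S(2,3,6) _ S(7)] a b S(4,5) seqs_add[OF a(1) b(1)]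
    by (auto simp: linrec_seqs_def)
qed

lemma linrec_smult_closed:
  assumes "r \<in> carrier R" "a \<in> linrec_seqs R"
  shows "(\<lambda>n. r \<otimes> a n) \<in> linrec_seqs R"
proof -
  interpret U: UP_cring R "UP R" using cring_axioms by (simp add: UP_cring_def)
  obtain N p where a: "a \<in> seqs R" "has_charpoly R N p a" "monic_of_degree R N p"
    using assms(2) by (rule linrec_seqsE)
  have [simp]: "p k \<in> carrier R" "a k \<in> carrier R" for k
    using U.carrier_nth[of p k] a(3) seqsD[OF a(1)] by (auto simp: monic_of_degree_def)
  have "(\<Oplus>k\<in>{..N}. p k \<otimes> (r \<otimes> a (m + k))) = r \<otimes> (\<Oplus>k\<in>{..N}. p k \<otimes> a (m + k))" for m
    using assms(1) by (subst finsum_rdistr) (auto simp: m_lcomm intro!: finsum_cong')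
  then have "has_charpoly R N p (\<lambda>n. r \<otimes> a n)"
    using a assms(1) has_charpoly_iff[OF a(1)] has_charpoly_iff[OF seqs_smult[OF assms(1) a(1)]]
    by simp
  then show ?thesis using seqs_smult[OF assms(1) a(1)] by (auto simp: linrec_seqs_def)
qed

lemma linrec_zero: "(\<lambda>n. \<zero>) \<in> linrec_seqs R"
proof -
  have "has_charpoly R 0 (monom (UP R) \<one> 0 \<ominus>\<^bsub>UP R\<^esub> (\<Oplus>\<^bsub>UP R\<^esub>i\<in>{1..0}. monom (UP R) \<zero> (0 - i))) (\<lambda>n. \<zero>)"
    unfolding has_charpoly_def by (intro bexI[of _ "\<lambda>_. \<zero>"]) auto
  then show ?thesis using seqs_zero by (auto simp: linrec_seqs_def)
qed

text \<open>The characteristic polynomial is \<open>t\<close>: the recurrence with coefficient 0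
  holds from index 1 on.\<close>

lemma linrec_one: "(\<lambda>n. if n = 0 then \<one> else \<zero>) \<in> linrec_seqs R"
proof -
  have "has_charpoly R 1 (monom (UP R) \<one> 1 \<ominus>\<^bsub>UP R\<^esub> (\<Oplus>\<^bsub>UP R\<^esub>i\<in>{1..1}. monom (UP R) \<zero> (1 - i)))
      (\<lambda>n. if n = 0 then \<one> else \<zero>)"
    unfolding has_charpoly_def by (intro bexI[of _ "\<lambda>_. \<zero>"]) auto
  then show ?thesis by (auto simp: linrec_seqs_def seqs_def)
qed

text \<open>Reduces identities for the Newton product to pointwise identities in
  \<open>R\<close>.\<close>

lemma newton_prod_eqI:
  assumes "u \<in> seqs R" "v \<in> seqs R" "\<And>n. binomial_transform R u n = binomial_transform R v n"
  shows "u = v"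
  using binomial_transform_inject[OF assms(1,2)] assms(3) by blast

lemma algebra_linrec: "algebra R (linrec_algebra R)"
proof -
  let ?W = "linrec_algebra R"
  have s: "u \<in> seqs R" if "u \<in> linrec_seqs R" for u using that by (simp add: linrec_seqs_def)
  note c [simp] = seqsD[OF s]
  note bt = binomial_transform_newton_prod binomial_transform_add binomial_transform_smult
    binomial_transform_one binomial_transform_closed s newton_prod_closed seqs_add seqs_smult
    linrec_one
  note closed = linrec_newton_prod_add_closed linrec_smult_closed linrec_zero linrec_one
  have "abelian_group ?W"
  proof (rule abelian_groupI)
    fix u assume "u \<in> carrier ?W"
    then have u: "u \<in> linrec_seqs R" by (simp add: linrec_algebra_def)
    \<comment> \<open>The additive inverse is the scalar multiple by -1, so its membership follows
      from closure under scalars.\<close>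
    have "(\<lambda>n. (\<ominus> \<one>) \<otimes> u n) \<in> linrec_seqs R" using u by (simp add: closed)
    moreover have "(\<lambda>n. (\<ominus> \<one>) \<otimes> u n \<oplus> u n) = (\<lambda>n. \<zero>)" using u by (auto simp: l_minus l_neg)
    ultimately show "\<exists>y\<in>carrier ?W. y \<oplus>\<^bsub>?W\<^esub> u = \<zero>\<^bsub>?W\<^esub>"
      by (auto simp: linrec_algebra_def)
  qed (auto simp: linrec_algebra_def closed a_ac)
  moreover have "comm_monoid ?W"
  proof (rule comm_monoidI)
    fix u v w assume "u \<in> carrier ?W" "v \<in> carrier ?W" "w \<in> carrier ?W"
    then have "u \<in> linrec_seqs R" "v \<in> linrec_seqs R" "w \<in> linrec_seqs R"
      by (simp_all add: linrec_algebra_def)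
    then show "u \<otimes>\<^bsub>?W\<^esub> v \<otimes>\<^bsub>?W\<^esub> w = u \<otimes>\<^bsub>?W\<^esub> (v \<otimes>\<^bsub>?W\<^esub> w)"
      by (intro newton_prod_eqI) (simp_all add: linrec_algebra_def bt m_assoc)
  next
    fix u v assume "u \<in> carrier ?W" "v \<in> carrier ?W"
    then have "u \<in> linrec_seqs R" "v \<in> linrec_seqs R" by (simp_all add: linrec_algebra_def)
    then show "u \<otimes>\<^bsub>?W\<^esub> v = v \<otimes>\<^bsub>?W\<^esub> u"
      by (intro newton_prod_eqI) (simp_all add: linrec_algebra_def bt m_comm)
  next
    fix u assume "u \<in> carrier ?W"
    then have "u \<in> linrec_seqs R" by (simp add: linrec_algebra_def)
    then show "\<one>\<^bsub>?W\<^esub> \<otimes>\<^bsub>?W\<^esub> u = u"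
      by (intro newton_prod_eqI) (simp_all add: linrec_algebra_def bt)
  qed (auto simp: linrec_algebra_def closed)
  moreover have "(u \<oplus>\<^bsub>?W\<^esub> v) \<otimes>\<^bsub>?W\<^esub> w = u \<otimes>\<^bsub>?W\<^esub> w \<oplus>\<^bsub>?W\<^esub> v \<otimes>\<^bsub>?W\<^esub> w"
    if "u \<in> carrier ?W" "v \<in> carrier ?W" "w \<in> carrier ?W" for u v w
  proof -
    have "u \<in> linrec_seqs R" "v \<in> linrec_seqs R" "w \<in> linrec_seqs R"
      using that by (simp_all add: linrec_algebra_def)
    then show ?thesis
      by (intro newton_prod_eqI) (simp_all add: linrec_algebra_def bt l_distr)
  qed
  ultimately have "cring ?W" by (rule cringI)
  then show ?thesis
  proof (rule algebraI[OF cring_axioms])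
    fix r u v assume "r \<in> carrier R" "u \<in> carrier ?W" "v \<in> carrier ?W"
    then have "r \<in> carrier R" "u \<in> linrec_seqs R" "v \<in> linrec_seqs R"
      by (simp_all add: linrec_algebra_def)
    then show "(r \<odot>\<^bsub>?W\<^esub> u) \<otimes>\<^bsub>?W\<^esub> v = r \<odot>\<^bsub>?W\<^esub> (u \<otimes>\<^bsub>?W\<^esub> v)"
      by (intro newton_prod_eqI) (simp_all add: linrec_algebra_def bt m_assoc)
  qed (auto simp: linrec_algebra_def closed l_distr r_distr m_assoc)
qed

end

theorem theorem9:
  fixes R :: "('a, 'm) ring_scheme"
  assumes "cring R"
  shows "(\<forall>a \<in> linrec_seqs R. \<forall>b \<in> linrec_seqs R. newton_prod R a b \<in> linrec_seqs R) \<and>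
    (\<forall>a \<in> linrec_seqs R. \<forall>b \<in> linrec_seqs R. \<forall>M N p\<^sub>a p\<^sub>b.
       \<forall>(S :: ('b, 'n) ring_scheme) \<phi> \<alpha> \<beta>.
         has_charpoly R M p\<^sub>a a \<longrightarrow> has_charpoly R N p\<^sub>b b \<longrightarrow>
         ring_extension R S \<phi> \<longrightarrow>
         has_roots R S \<phi> p\<^sub>a M \<alpha> \<longrightarrow> has_roots R S \<phi> p\<^sub>b N \<beta> \<longrightarrow>
         (\<exists>q \<in> carrier (UP R).
            UP_map R \<phi> q =
              (\<Otimes>\<^bsub>UP S\<^esub>i\<in>{1..M}. \<Otimes>\<^bsub>UP S\<^esub>j\<in>{1..N}.
                 lin_factor S (\<alpha> i \<oplus>\<^bsub>S\<^esub> \<beta> j \<oplus>\<^bsub>S\<^esub> \<alpha> i \<otimes>\<^bsub>S\<^esub> \<beta> j)) \<and>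
            has_charpoly R (M * N) q (newton_prod R a b))) \<and>
    algebra R (linrec_algebra R)"
proof (intro conjI ballI allI impI)
  interpret R: cring R by (rule assms)
  show "newton_prod R a b \<in> linrec_seqs R" if "a \<in> linrec_seqs R" "b \<in> linrec_seqs R" for a b
    using that by (rule R.linrec_newton_prod_add_closed)
  show "algebra R (linrec_algebra R)" by (rule R.algebra_linrec)
  fix a b M N p\<^sub>a p\<^sub>b and S :: "('b, 'n) ring_scheme" and \<phi> \<alpha> \<beta>
  assume a: "a \<in> linrec_seqs R" and b: "b \<in> linrec_seqs R"
    and pa: "has_charpoly R M p\<^sub>a a" and pb: "has_charpoly R N p\<^sub>b b" and ext: "ring_extension R S \<phi>"
    and \<alpha>: "has_roots R S \<phi> p\<^sub>a M \<alpha>" and \<beta>: "has_roots R S \<phi> p\<^sub>b N \<beta>"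
  interpret cring_embedding R S \<phi>
    using ext assms by (auto simp: ring_extension_def intro: cring_embeddingI)
  interpret RP: UP_cring R "UP R" using assms by (simp add: UP_cring_def)
  interpret SP: UP_cring S "UP S" using S.cring_axioms by (simp add: UP_cring_def)
  have seqs: "a \<in> seqs R" "b \<in> seqs R" using a b by (auto simp: linrec_seqs_def)
  have map_eq: "UP_map R \<phi> f = (\<lambda>k. \<phi> (f k))" if "f \<in> carrier (UP R)" for f
    using RP.coeff_eq[OF that] by (simp add: UP_map_def)
  have carr: "p\<^sub>a \<in> carrier (UP R)" "p\<^sub>b \<in> carrier (UP R)"
    using pa pb R.has_charpoly_iff seqs by (auto simp: monic_of_degree_def)
  \<comment> \<open>The indexed roots become lists, which lets \<open>finprod_lin_factor\<close>
    turn \<open>has_roots\<close> into a statement about \<open>root_coeffs\<close>.\<close>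
  define as bs where "as = map \<alpha> [1..<Suc M]" and "bs = map \<beta> [1..<Suc N]"
  have \<alpha>S: "\<alpha> i \<in> carrier S" if "i \<in> {1..M}" for i using \<alpha> that by (auto simp: has_roots_def)
  have \<beta>S: "\<beta> j \<in> carrier S" if "j \<in> {1..N}" for j using \<beta> that by (auto simp: has_roots_def)
  have sets: "set as \<subseteq> carrier S" "set bs \<subseteq> carrier S"
    using \<alpha>S \<beta>S by (auto simp: as_def bs_def)
  have len: "length as = M" "length bs = N" by (simp_all add: as_def bs_def)
  have rc: "root_coeffs S as = (\<lambda>k. \<phi> (p\<^sub>a k))" "root_coeffs S bs = (\<lambda>k. \<phi> (p\<^sub>b k))"
    using \<alpha> \<beta> SP.finprod_lin_factor[of \<alpha> M] SP.finprod_lin_factor[of \<beta> N] map_eq carr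
    by (auto simp: has_roots_def as_def bs_def)
  obtain q where q: "q \<in> carrier (UP R)" "has_charpoly R (M * N) q (newton_prod R a b)"
      "root_coeffs S (circle_roots S as bs) = (\<lambda>k. \<phi> (q k))"
    using has_charpoly_newton_prod[OF seqs sets rc(1) _ rc(2)] pa pb len by auto
  let ?\<gamma> = "\<lambda>i j. \<alpha> i \<oplus>\<^bsub>S\<^esub> \<beta> j \<oplus>\<^bsub>S\<^esub> \<alpha> i \<otimes>\<^bsub>S\<^esub> \<beta> j"
  have \<gamma>: "set (map (?\<gamma> i) [1..<Suc N]) \<subseteq> carrier S" if "i \<in> {1..M}" for i
    using \<alpha>S[OF that] \<beta>S by auto
  \<comment> \<open>The double product is collected row by row into the polynomial of one
    concatenated list, which is \<open>circle_roots S as bs\<close>.\<close>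
  have "(\<Otimes>\<^bsub>UP S\<^esub>i\<in>{1..M}. \<Otimes>\<^bsub>UP S\<^esub>j\<in>{1..N}. lin_factor S (?\<gamma> i j)) =
    (\<Otimes>\<^bsub>UP S\<^esub>i\<in>{1..M}. root_coeffs S (map (?\<gamma> i) [1..<Suc N]))"
  proof (rule comm_monoid.finprod_cong'[OF cring.axioms(2)[OF SP.UP_cring]])
    show "(\<lambda>i. root_coeffs S (map (?\<gamma> i) [1..<Suc N])) \<in> {1..M} \<rightarrow> carrier (UP S)"
      using SP.root_coeffs_in_carrier[OF \<gamma>] by blast
    show "(\<Otimes>\<^bsub>UP S\<^esub>j\<in>{1..N}. lin_factor S (?\<gamma> i j)) = root_coeffs S (map (?\<gamma> i) [1..<Suc N])"
      if "i \<in> {1..M}" for i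
      using \<alpha>S[OF that] \<beta>S by (intro SP.finprod_lin_factor) auto
  qed simp
  also have "\<dots> = root_coeffs S (concat (map (\<lambda>i. map (?\<gamma> i) [1..<Suc N]) [1..<Suc M]))"
    using \<gamma> by (rule SP.finprod_root_coeffs)
  also have "concat (map (\<lambda>i. map (?\<gamma> i) [1..<Suc N]) [1..<Suc M]) = circle_roots S as bs"
    by (simp add: circle_roots_def as_def bs_def comp_def)
  finally show "\<exists>q \<in> carrier (UP R).
      UP_map R \<phi> q = (\<Otimes>\<^bsub>UP S\<^esub>i\<in>{1..M}. \<Otimes>\<^bsub>UP S\<^esub>j\<in>{1..N}. lin_factor S (?\<gamma> i j)) \<and>
      has_charpoly R (M * N) q (newton_prod R a b)"
    using q map_eq[OF q(1)] by (intro bexI[of _ q]) simp_all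
qed

end
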